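(* Let $A$ be a Noetherian integral domain of characteristic zero. Then $H^1_{fl}(\mathcal{M}_{fmA}^{2\text{-}buds}; \omega)$ is a finite abelian group of order equal to $2^{N_1}$, where $N_1$ is the number of $\mathbb{F}_2$-points of $\mathrm{Spec}\, A$ (i.e., of ring homomorphisms $A\to\mathbb{F}_2$), i.e., the logarithmic derivative of the $2$-local zeta-function $Z(\mathrm{Spec}\, A,t)$ evaluated at $t=0$.
   Context: The local zeta-function of $V=\mathrm{Spec}\,A$ at a prime $p$ is $Z(V,t)=\exp\left(\sum_{m\ge1}\frac{N_m}{m}t^m\right)$, where $N_m$ is the number of $\mathbb{F}_{p^m}$-points of $V$; here $p=2$. Formal $A$-module 2-buds: for a commutative ring $A$ and commutative $A$-algebra $R$, a formal $A$-module $2$-bud over $R$ is an element $F\in R[[X,Y]]/(X,Y)^3$ satisfying the commutative formal group law axioms modulo $(X,Y)^3$, with a ring homomorphism $\rho:A\to\mathrm{End}(F)\subseteq R[[X]]/(X^3)$ (addition $F(f,g)$, multiplication composition) with $\rho(a)\equiv aX \bmod X^2$. Strict isomorphisms are isomorphisms $f\equiv X \bmod X^2$. The groupoid of these is corepresented by the graded Hopf algebroid $(L^A_{2\text{-}buds},L^A_{2\text{-}buds}B)$ described as follows. Let $\mathrm{Dr}^A$ be the $A$-module generated by symbols $\gamma$ and $c_a$ ($a\in A$), in degree $2$, subject to $(a^2-a)\gamma=2c_a$, $c_{a+b}-c_a-c_b=ab\gamma$, $ac_b+b^2c_a=c_{ab}$ for all $a,b\in A$. Then $L^A_{2\text{-}buds}=\mathrm{Sym}_A(\mathrm{Dr}^A)$,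 $L^A_{2\text{-}buds}B=L^A_{2\text{-}buds}[t]$ with $|t|=2$, $\eta_L(x)=x$, $\eta_R(\gamma)=\gamma+2t$, $\eta_R(c_a)=c_a+(a^2-a)t$, $\Delta(t)=t\otimes1+1\otimes t$, $\epsilon(t)=0$. $\mathcal{M}_{fmA}^{2\text{-}buds}$ is the Artin stack obtained by stackifying the groupoid scheme $(\mathrm{Spec}\,L^A_{2\text{-}buds},\mathrm{Spec}\,L^A_{2\text{-}buds}B)$, $\omega$ is its line bundle of invariant differentials (corresponding to the graded comodule $\Sigma^2L^A_{2\text{-}buds}$), and its flat cohomology is $H^s_{fl}(\mathcal{M}_{fmA}^{2\text{-}buds};\omega^{\otimes n})=\mathrm{Cotor}^{s,2n}_{L^A_{2\text{-}buds}B}(L^A_{2\text{-}buds},L^A_{2\text{-}buds})$, the cohomology of the cobar complex in cohomological degree $s$ and internal degree $2n$. *)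

theory Defs
  imports
    "HOL-Algebra.Free_Abelian_Groups"
    "HOL-Algebra.Ring_Divisibility"
    "HOL-Algebra.Algebraic_Closure_Type"
    "HOL-Computational_Algebra.Formal_Power_Series"
    "HOL-Library.Z2"
begin

section \<open>The module of 2-buds\<close>

lemma lookup_scale:
  "Poly_Mapping.lookup (Poly_Mapping.map ((*) (a :: 'a :: comm_ring_1)) p) k = a * Poly_Mapping.lookup p k"
  by (simp add: Poly_Mapping.map.rep_eq when_def)

global_interpretation free_module: Modules.module
  "\<lambda>a. Poly_Mapping.map ((*) (a :: 'a :: comm_ring_1)) :: ('b \<Rightarrow>\<^sub>0 'a) \<Rightarrow> ('b \<Rightarrow>\<^sub>0 'a)"
  by standard (rule poly_mapping_eqI, simp add: lookup_add lookup_scale algebra_simps)+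

lemma self_module: "Modules.module ((*) :: 'a :: comm_ring_1 \<Rightarrow> 'a \<Rightarrow> 'a)"
  by standard (simp_all add: algebra_simps)

(* Not an interpretation: the simp rule scale_scale would undo associativity of multiplication. *)
abbreviation ideal_span :: "'a :: comm_ring_1 set \<Rightarrow> 'a set" where
  "ideal_span \<equiv> Modules.module.span (*)"

lemmas ideal_span_base = Modules.module.span_base[OF self_module]
   and ideal_span_zero = Modules.module.span_zero[OF self_module]
   and ideal_span_add = Modules.module.span_add[OF self_module]
   and ideal_span_diff = Modules.module.span_diff[OF self_module]
   and ideal_span_neg = Modules.module.span_neg[OF self_module]
   and ideal_span_scale = Modules.module.span_scale[OF self_module]
   and ideal_span_induct_alt = Modules.module.span_induct_alt[OF self_module, consumes 1, case_names base step]

datatype 'a dr_symbol = Sym_gamma | Sym_c 'a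

text \<open>
  The defining relations of \<open>Dr\<^sup>A\<close> inside the free \<open>A\<close>-module on the symbols:
  \<open>(a\<^sup>2 - a) \<gamma> = 2 c\<^sub>a\<close>, \<open>c\<^bsub>a+b\<^esub> - c\<^sub>a - c\<^sub>b = a b \<gamma>\<close> and
  \<open>a c\<^sub>b + b\<^sup>2 c\<^sub>a = c\<^bsub>ab\<^esub>\<close>.
\<close>

definition dr_relations :: "('a :: comm_ring_1 dr_symbol \<Rightarrow>\<^sub>0 'a) set" where
  "dr_relations =
     {Poly_Mapping.single Sym_gamma (a^2 - a) - Poly_Mapping.single (Sym_c a) 2 | a. True}
   \<union> {Poly_Mapping.single (Sym_c (a + b)) 1 - Poly_Mapping.single (Sym_c a) 1
        - Poly_Mapping.single (Sym_c b) 1 - Poly_Mapping.single Sym_gamma (a * b) | a b. True}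
   \<union> {Poly_Mapping.single (Sym_c b) a + Poly_Mapping.single (Sym_c a) (b^2)
        - Poly_Mapping.single (Sym_c (a * b)) 1 | a b. True}"

quotient_type (overloaded) 'a Dr = "'a :: comm_ring_1 dr_symbol \<Rightarrow>\<^sub>0 'a"
  / "\<lambda>x y. x - y \<in> free_module.span dr_relations"
proof (rule equivpI)
  let ?R = "free_module.span (dr_relations :: ('a dr_symbol \<Rightarrow>\<^sub>0 'a) set)"
  show "reflp (\<lambda>x y. x - y \<in> ?R)"
    by (rule reflpI) (simp add: free_module.span_zero)
  show "symp (\<lambda>x y. x - y \<in> ?R)"
  proof (rule sympI)
    fix x y assume "x - y \<in> ?R"
    from free_module.span_neg[OF this] show "y - x \<in> ?R" by simp
  qed
  show "transp (\<lambda>x y. x - y \<in> ?R)"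
  proof (rule transpI)
    fix x y z assume "x - y \<in> ?R" "y - z \<in> ?R"
    from free_module.span_add[OF this] show "x - z \<in> ?R" by simp
  qed
qed

instantiation Dr :: (comm_ring_1) ab_group_add
begin

lift_definition zero_Dr :: "'a Dr" is 0 .

lift_definition plus_Dr :: "'a Dr \<Rightarrow> 'a Dr \<Rightarrow> 'a Dr" is "(+)"
proof -
  fix x x' y y' :: "'a dr_symbol \<Rightarrow>\<^sub>0 'a"
  assume "x - x' \<in> free_module.span dr_relations" "y - y' \<in> free_module.span dr_relations"
  from free_module.span_add[OF this] show "x + y - (x' + y') \<in> free_module.span dr_relations"
    by (simp add: algebra_simps)
qed

lift_definition uminus_Dr :: "'a Dr \<Rightarrow> 'a Dr" is uminus
proof -
  fix x x' :: "'a dr_symbol \<Rightarrow>\<^sub>0 'a"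
  assume "x - x' \<in> free_module.span dr_relations"
  from free_module.span_neg[OF this] show "- x - - x' \<in> free_module.span dr_relations"
    by (simp add: algebra_simps)
qed

lift_definition minus_Dr :: "'a Dr \<Rightarrow> 'a Dr \<Rightarrow> 'a Dr" is "(-)"
proof -
  fix x x' y y' :: "'a dr_symbol \<Rightarrow>\<^sub>0 'a"
  assume "x - x' \<in> free_module.span dr_relations" "y - y' \<in> free_module.span dr_relations"
  from free_module.span_diff[OF this] show "x - y - (x' - y') \<in> free_module.span dr_relations"
    by (simp add: algebra_simps)
qed

instance
proof
  fix x y z :: "'a Dr"
  show "x + y + z = x + (y + z)"
    by transfer (simp add: add.assoc free_module.span_zero)
  show "x + y = y + x"
    by transfer (simp add: add.commute free_module.span_zero)
  show "0 + x = x"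
    by transfer (simp add: free_module.span_zero)
  show "- x + x = 0"
    by transfer (simp add: free_module.span_zero)
  show "x - y = x + - y"
    by transfer (simp add: free_module.span_zero)
qed

end

lift_definition dr_scale :: "'a :: comm_ring_1 \<Rightarrow> 'a Dr \<Rightarrow> 'a Dr"
  is "\<lambda>a. Poly_Mapping.map ((*) a)"
proof -
  fix a :: 'a and x x' :: "'a dr_symbol \<Rightarrow>\<^sub>0 'a"
  assume "x - x' \<in> free_module.span dr_relations"
  from free_module.span_scale[OF this, of a]
  show "Poly_Mapping.map ((*) a) x - Poly_Mapping.map ((*) a) x' \<in> free_module.span dr_relations"
    by (simp add: free_module.scale_right_diff_distrib)
qed

lift_definition dr_gamma :: "'a :: comm_ring_1 Dr" is "Poly_Mapping.single Sym_gamma 1" .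

lift_definition dr_c :: "'a :: comm_ring_1 \<Rightarrow> 'a Dr" is "\<lambda>a. Poly_Mapping.single (Sym_c a) 1" .


section \<open>Linear and polynomial extension of maps on generators\<close>

definition linear_extension :: "('b \<Rightarrow> 'a :: comm_ring_1) \<Rightarrow> ('b \<Rightarrow>\<^sub>0 'a) \<Rightarrow> 'a" where
  "linear_extension f x = (\<Sum>s\<in>Poly_Mapping.keys x. Poly_Mapping.lookup x s * f s)"

lemma linear_extension_superset:
  "finite S \<Longrightarrow> Poly_Mapping.keys x \<subseteq> S \<Longrightarrow> linear_extension f x = (\<Sum>s\<in>S. Poly_Mapping.lookup x s * f s)"
  unfolding linear_extension_def
  by (rule sum.mono_neutral_left) (auto simp: in_keys_iff)

lemma linear_extension_single [simp]: "linear_extension f (Poly_Mapping.single s a) = a * f s"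
  by (subst linear_extension_superset[of "{s}"]) auto

lemma linear_extension_zero [simp]: "linear_extension f 0 = 0"
  by (simp add: linear_extension_def)

lemma linear_extension_add: "linear_extension f (x + y) = linear_extension f x + linear_extension f y"
proof -
  have "Poly_Mapping.keys (x + y) \<subseteq> Poly_Mapping.keys x \<union> Poly_Mapping.keys y" by (rule Poly_Mapping.keys_add)
  then show ?thesis
    by (simp add: linear_extension_superset[of "Poly_Mapping.keys x \<union> Poly_Mapping.keys y"] lookup_add algebra_simps sum.distrib)
qed

lemma linear_extension_scale:
  "linear_extension f (Poly_Mapping.map ((*) a) x) = a * linear_extension f x"
proof -
  have "Poly_Mapping.keys (Poly_Mapping.map ((*) a) x) \<subseteq> Poly_Mapping.keys x"
    by (auto simp: in_keys_iff lookup_scale)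
  then show ?thesis
    by (simp add: linear_extension_superset[of "Poly_Mapping.keys x"] lookup_scale algebra_simps sum_distrib_left)
qed

lemma linear_extension_diff: "linear_extension f (x - y) = linear_extension f x - linear_extension f y"
  using linear_extension_add[of f "x - y" y] by (simp add: algebra_simps)

definition monomial_eval :: "('m \<Rightarrow> 'b :: comm_ring_1) \<Rightarrow> ('m \<Rightarrow>\<^sub>0 nat) \<Rightarrow> 'b" where
  "monomial_eval v \<mu> = (\<Prod>x\<in>Poly_Mapping.keys \<mu>. v x ^ Poly_Mapping.lookup \<mu> x)"

definition polynomial_eval ::
    "('a :: comm_ring_1 \<Rightarrow> 'b :: comm_ring_1) \<Rightarrow> ('m \<Rightarrow> 'b) \<Rightarrow> (('m \<Rightarrow>\<^sub>0 nat) \<Rightarrow>\<^sub>0 'a) \<Rightarrow> 'b" where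
  "polynomial_eval h v p = (\<Sum>\<mu>\<in>Poly_Mapping.keys p. h (Poly_Mapping.lookup p \<mu>) * monomial_eval v \<mu>)"

lemma monomial_eval_superset:
  "finite S \<Longrightarrow> Poly_Mapping.keys \<mu> \<subseteq> S \<Longrightarrow> monomial_eval v \<mu> = (\<Prod>x\<in>S. v x ^ Poly_Mapping.lookup \<mu> x)"
  unfolding monomial_eval_def
  by (rule prod.mono_neutral_left) (auto simp: in_keys_iff)

lemma monomial_eval_zero [simp]: "monomial_eval v 0 = 1"
  by (simp add: monomial_eval_def)

lemma monomial_eval_single [simp]: "monomial_eval v (Poly_Mapping.single x n) = v x ^ n"
  by (subst monomial_eval_superset[of "{x}"]) auto

lemma monomial_eval_add: "monomial_eval v (\<mu> + \<nu>) = monomial_eval v \<mu> * monomial_eval v \<nu>"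
proof -
  have "Poly_Mapping.keys (\<mu> + \<nu>) \<subseteq> Poly_Mapping.keys \<mu> \<union> Poly_Mapping.keys \<nu>" by (rule Poly_Mapping.keys_add)
  then show ?thesis
    by (simp add: monomial_eval_superset[of "Poly_Mapping.keys \<mu> \<union> Poly_Mapping.keys \<nu>"] lookup_add power_add prod.distrib)
qed

locale scalar_hom =
  fixes h :: "'a :: comm_ring_1 \<Rightarrow> 'b :: comm_ring_1"
  assumes hom_add: "h (a + b) = h a + h b"
    and hom_mult: "h (a * b) = h a * h b"
    and hom_one: "h 1 = 1"
begin

lemma hom_zero: "h 0 = 0"
  using hom_add[of 0 0] by simp

lemma eval_superset:
  "finite S \<Longrightarrow> Poly_Mapping.keys p \<subseteq> S \<Longrightarrow>
     polynomial_eval h v p = (\<Sum>\<mu>\<in>S. h (Poly_Mapping.lookup p \<mu>) * monomial_eval v \<mu>)"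
  unfolding polynomial_eval_def
  by (rule sum.mono_neutral_left) (auto simp: in_keys_iff hom_zero)

lemma eval_zero [simp]: "polynomial_eval h v 0 = 0"
  by (simp add: polynomial_eval_def)

lemma eval_single [simp]: "polynomial_eval h v (Poly_Mapping.single \<mu> a) = h a * monomial_eval v \<mu>"
  by (subst eval_superset[of "{\<mu>}"]) (auto simp: hom_zero)

lemma eval_one [simp]: "polynomial_eval h v 1 = 1"
  using eval_single[of v 0 1] by (simp add: hom_one)

lemma eval_add: "polynomial_eval h v (p + q) = polynomial_eval h v p + polynomial_eval h v q"
proof -
  have "Poly_Mapping.keys (p + q) \<subseteq> Poly_Mapping.keys p \<union> Poly_Mapping.keys q" by (rule Poly_Mapping.keys_add)
  then show ?thesis
    by (simp add: eval_superset[of "Poly_Mapping.keys p \<union> Poly_Mapping.keys q"] lookup_add hom_add algebra_simps sum.distrib)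
qed

lemma eval_diff: "polynomial_eval h v (p - q) = polynomial_eval h v p - polynomial_eval h v q"
  using eval_add[of v "p - q" q] by (simp add: algebra_simps)

lemma eval_sum: "polynomial_eval h v (\<Sum>i\<in>I. f i) = (\<Sum>i\<in>I. polynomial_eval h v (f i))"
  by (induction I rule: infinite_finite_induct) (auto simp: eval_add)

lemma eval_mult: "polynomial_eval h v (p * q) = polynomial_eval h v p * polynomial_eval h v q"
proof -
  have expand: "r = (\<Sum>\<mu>\<in>Poly_Mapping.keys r. Poly_Mapping.single \<mu> (Poly_Mapping.lookup r \<mu>))"
    for r :: "('c \<Rightarrow>\<^sub>0 nat) \<Rightarrow>\<^sub>0 'a"
    by (rule poly_mapping_eqI)
      (auto simp: lookup_sum lookup_single when_def in_keys_iff)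
  have "polynomial_eval h v (p * q) = polynomial_eval h v
      ((\<Sum>\<mu>\<in>Poly_Mapping.keys p. Poly_Mapping.single \<mu> (Poly_Mapping.lookup p \<mu>)) *
       (\<Sum>\<nu>\<in>Poly_Mapping.keys q. Poly_Mapping.single \<nu> (Poly_Mapping.lookup q \<nu>)))"
    by (simp only: expand[symmetric])
  also have "\<dots> = (\<Sum>\<mu>\<in>Poly_Mapping.keys p. \<Sum>\<nu>\<in>Poly_Mapping.keys q.
      (h (Poly_Mapping.lookup p \<mu>) * monomial_eval v \<mu>) * (h (Poly_Mapping.lookup q \<nu>) * monomial_eval v \<nu>))"
    unfolding sum_product eval_sum mult_single eval_single monomial_eval_add hom_mult
    by (simp only: mult_ac)
  also have "\<dots> = polynomial_eval h v p * polynomial_eval h v q"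
    by (simp add: polynomial_eval_def sum_product)
  finally show ?thesis .
qed

lemma eval_ideal:
  assumes "p \<in> ideal_span R" and "\<And>r. r \<in> R \<Longrightarrow> polynomial_eval h v r = 0"
  shows "polynomial_eval h v p = 0"
  using assms(1)
proof (induction rule: ideal_span_induct_alt)
  case (step c x y)
  then show ?case by (simp add: eval_add eval_mult assms(2))
qed simp

end

text \<open>
  The \<open>A\<close>-linear map with \<open>\<gamma> \<mapsto> 2\<close> and \<open>c\<^sub>a \<mapsto> a\<^sup>2 - a\<close>: on \<open>Dr\<^sup>A\<close> the right unit
  is \<open>x \<mapsto> x + dr_twist x \<cdot> t\<close>.
\<close>

lift_definition dr_twist :: "'a :: comm_ring_1 Dr \<Rightarrow> 'a"
  is "linear_extension (\<lambda>s. case s of Sym_gamma \<Rightarrow> 2 | Sym_c a \<Rightarrow> a^2 - a)"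
proof -
  let ?f = "\<lambda>s :: 'a dr_symbol. case s of Sym_gamma \<Rightarrow> 2 | Sym_c a \<Rightarrow> a^2 - a"
  fix x y :: "'a dr_symbol \<Rightarrow>\<^sub>0 'a"
  assume "x - y \<in> free_module.span dr_relations"
  then have "linear_extension ?f (x - y) = 0"
  proof (induction rule: free_module.span_induct_alt)
    case (step c x y)
    have "linear_extension ?f x = 0"
    proof -
      have 1: "linear_extension ?f (Poly_Mapping.single Sym_gamma (a^2 - a) - Poly_Mapping.single (Sym_c a) 2) = 0"
        for a
        unfolding linear_extension_diff linear_extension_single dr_symbol.case by (simp only: mult.commute) simp
      have 2: "linear_extension ?f (Poly_Mapping.single (Sym_c (a + b)) 1 - Poly_Mapping.single (Sym_c a) 1
            - Poly_Mapping.single (Sym_c b) 1 - Poly_Mapping.single Sym_gamma (a * b)) = 0" for a b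
        unfolding linear_extension_diff linear_extension_single dr_symbol.case
        by (simp add: power2_eq_square algebra_simps)
      have 3: "linear_extension ?f (Poly_Mapping.single (Sym_c b) a + Poly_Mapping.single (Sym_c a) (b^2)
            - Poly_Mapping.single (Sym_c (a * b)) 1) = 0" for a b
        unfolding linear_extension_diff linear_extension_add linear_extension_single dr_symbol.case
        by (simp add: power2_eq_square algebra_simps)
      show ?thesis
        using step(1) 1 2 3 unfolding dr_relations_def by blast
    qed
    then show ?case
      by (simp add: linear_extension_add linear_extension_scale step)
  qed simp
  then show "linear_extension ?f x = linear_extension ?f y"
    by (simp add: linear_extension_diff)
qed


section \<open>The Hopf algebroid\<close>

definition sym_var :: "'m \<Rightarrow> ('m \<Rightarrow>\<^sub>0 nat) \<Rightarrow>\<^sub>0 'a :: comm_ring_1" where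
  "sym_var x = Poly_Mapping.single (Poly_Mapping.single x 1) 1"

text \<open>
  \<open>Sym\<^sub>A(Dr\<^sup>A)\<close> is the polynomial ring with one variable for every element of \<open>Dr\<^sup>A\<close>, modulo
  the ideal that makes the inclusion of \<open>Dr\<^sup>A\<close> an \<open>A\<close>-linear map. Its elements are written as
  finitely supported functions from monomials to coefficients.
\<close>

definition sym_relations :: "(('a :: comm_ring_1 Dr \<Rightarrow>\<^sub>0 nat) \<Rightarrow>\<^sub>0 'a) set" where
  "sym_relations =
     {sym_var (x + y) - sym_var x - sym_var y | x y. True}
   \<union> {sym_var (dr_scale a x) - Poly_Mapping.single 0 a * sym_var x | a x. True}"

quotient_type (overloaded) 'a lbuds = "('a :: comm_ring_1 Dr \<Rightarrow>\<^sub>0 nat) \<Rightarrow>\<^sub>0 'a"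
  / "\<lambda>p q. p - q \<in> ideal_span sym_relations"
proof (rule equivpI)
  let ?R = "ideal_span (sym_relations :: (('a Dr \<Rightarrow>\<^sub>0 nat) \<Rightarrow>\<^sub>0 'a) set)"
  show "reflp (\<lambda>x y. x - y \<in> ?R)"
    by (rule reflpI) (simp add: ideal_span_zero)
  show "symp (\<lambda>x y. x - y \<in> ?R)"
  proof (rule sympI)
    fix x y assume "x - y \<in> ?R"
    from ideal_span_neg[OF this] show "y - x \<in> ?R" by simp
  qed
  show "transp (\<lambda>x y. x - y \<in> ?R)"
  proof (rule transpI)
    fix x y z assume "x - y \<in> ?R" "y - z \<in> ?R"
    from ideal_span_add[OF this] show "x - z \<in> ?R" by simp
  qed
qed

instantiation lbuds :: (comm_ring_1) comm_ring_1
begin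

lift_definition zero_lbuds :: "'a lbuds" is 0 .

lift_definition one_lbuds :: "'a lbuds" is 1 .

lift_definition plus_lbuds :: "'a lbuds \<Rightarrow> 'a lbuds \<Rightarrow> 'a lbuds" is "(+)"
proof -
  fix x x' y y' :: "('a Dr \<Rightarrow>\<^sub>0 nat) \<Rightarrow>\<^sub>0 'a"
  assume "x - x' \<in> ideal_span sym_relations" "y - y' \<in> ideal_span sym_relations"
  from ideal_span_add[OF this] show "x + y - (x' + y') \<in> ideal_span sym_relations"
    by (simp add: algebra_simps)
qed

lift_definition uminus_lbuds :: "'a lbuds \<Rightarrow> 'a lbuds" is uminus
proof -
  fix x x' :: "('a Dr \<Rightarrow>\<^sub>0 nat) \<Rightarrow>\<^sub>0 'a"
  assume "x - x' \<in> ideal_span sym_relations"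
  from ideal_span_neg[OF this] show "- x - - x' \<in> ideal_span sym_relations"
    by (simp add: algebra_simps)
qed

lift_definition minus_lbuds :: "'a lbuds \<Rightarrow> 'a lbuds \<Rightarrow> 'a lbuds" is "(-)"
proof -
  fix x x' y y' :: "('a Dr \<Rightarrow>\<^sub>0 nat) \<Rightarrow>\<^sub>0 'a"
  assume "x - x' \<in> ideal_span sym_relations" "y - y' \<in> ideal_span sym_relations"
  from ideal_span_diff[OF this] show "x - y - (x' - y') \<in> ideal_span sym_relations"
    by (simp add: algebra_simps)
qed

lift_definition times_lbuds :: "'a lbuds \<Rightarrow> 'a lbuds \<Rightarrow> 'a lbuds" is "(*)"
proof -
  fix x x' y y' :: "('a Dr \<Rightarrow>\<^sub>0 nat) \<Rightarrow>\<^sub>0 'a"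
  assume 1: "x - x' \<in> ideal_span sym_relations" and 2: "y - y' \<in> ideal_span sym_relations"
  have "y * (x - x') + x' * (y - y') \<in> ideal_span sym_relations"
    by (intro ideal_span_add ideal_span_scale 1 2)
  also have "y * (x - x') + x' * (y - y') = x * y - x' * y'"
    by (simp add: algebra_simps)
  finally show "x * y - x' * y' \<in> ideal_span sym_relations" .
qed

lemma one_notin_sym_relations:
  "1 \<notin> ideal_span (sym_relations :: (('a Dr \<Rightarrow>\<^sub>0 nat) \<Rightarrow>\<^sub>0 'a) set)"
proof
  interpret id_hom: scalar_hom "\<lambda>a :: 'a. a"
    by standard simp_all
  assume one: "1 \<in> ideal_span (sym_relations :: (('a Dr \<Rightarrow>\<^sub>0 nat) \<Rightarrow>\<^sub>0 'a) set)"
  have "polynomial_eval (\<lambda>a. a) (\<lambda>_. 0) (1 :: ('a Dr \<Rightarrow>\<^sub>0 nat) \<Rightarrow>\<^sub>0 'a) = 0"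
  proof (rule id_hom.eval_ideal[OF one])
    fix r :: "('a Dr \<Rightarrow>\<^sub>0 nat) \<Rightarrow>\<^sub>0 'a" assume "r \<in> sym_relations"
    then show "polynomial_eval (\<lambda>a. a) (\<lambda>_. 0) r = 0"
      unfolding sym_relations_def by (auto simp: sym_var_def id_hom.eval_diff id_hom.eval_mult)
  qed
  then show False
    by simp
qed

instance
proof
  fix x y z :: "'a lbuds"
  show "x * y * z = x * (y * z)"
    by transfer (simp add: mult.assoc ideal_span_zero)
  show "x * y = y * x"
    by transfer (simp add: mult.commute ideal_span_zero)
  show "1 * x = x"
    by transfer (simp add: ideal_span_zero)
  show "x + y + z = x + (y + z)"
    by transfer (simp add: add.assoc ideal_span_zero)
  show "x + y = y + x"
    by transfer (simp add: add.commute ideal_span_zero)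
  show "0 + x = x"
    by transfer (simp add: ideal_span_zero)
  show "- x + x = 0"
    by transfer (simp add: ideal_span_zero)
  show "x - y = x + - y"
    by transfer (simp add: ideal_span_zero)
  show "(x + y) * z = x * z + y * z"
    by transfer (simp add: distrib_right ideal_span_zero)
  have "(1 :: 'a lbuds) \<noteq> 0"
    by transfer (simp add: one_notin_sym_relations)
  then show "(0 :: 'a lbuds) \<noteq> 1"
    by (rule not_sym)
qed

end

lift_definition lbuds_const :: "'a :: comm_ring_1 \<Rightarrow> 'a lbuds" is "Poly_Mapping.single 0" .

definition lbuds_incl :: "'a :: comm_ring_1 Dr \<Rightarrow> 'a lbuds" where
  "lbuds_incl x = abs_lbuds (sym_var x)"

lemma lbuds_const_simps [simp]:
  "lbuds_const 0 = 0"
  "lbuds_const 1 = 1"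
  "lbuds_const (a + b) = lbuds_const a + lbuds_const b"
  "lbuds_const (a - b) = lbuds_const a - lbuds_const b"
  "lbuds_const (a * b) = lbuds_const a * lbuds_const b"
  by (transfer; simp add: single_add single_diff mult_single ideal_span_zero)+

lemma lbuds_incl_add: "lbuds_incl (x + y) = lbuds_incl x + lbuds_incl y"
proof -
  have "sym_var (x + y) - sym_var x - sym_var y \<in> ideal_span sym_relations"
    by (rule ideal_span_base) (auto simp: sym_relations_def)
  then show ?thesis
    by (simp add: lbuds_incl_def plus_lbuds.abs_eq lbuds.abs_eq_iff algebra_simps)
qed

lemma lbuds_incl_scale: "lbuds_incl (dr_scale a x) = lbuds_const a * lbuds_incl x"
proof -
  have "sym_var (dr_scale a x) - Poly_Mapping.single 0 a * sym_var x \<in> ideal_span sym_relations"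
    by (rule ideal_span_base) (auto simp: sym_relations_def)
  then show ?thesis
    by (simp add: lbuds_incl_def lbuds_const.abs_eq times_lbuds.abs_eq lbuds.abs_eq_iff)
qed

lemma dr_twist_simps [simp]:
  "dr_twist dr_gamma = 2"
  "dr_twist (dr_c a) = a^2 - a"
  "dr_twist (x + y) = dr_twist x + dr_twist y"
  "dr_twist (dr_scale a x) = a * dr_twist x"
  by (transfer; simp add: linear_extension_add linear_extension_scale)+

text \<open>
  The ring \<open>L\<^sup>A\<^bsub>2-buds\<^esub>B = L\<^sup>A\<^bsub>2-buds\<^esub>[t]\<close> is \<^typ>\<open>'a lbuds poly\<close>; the right unit is the ring
  homomorphism characterised by \<open>eta_R_hom\<close>, \<open>eta_R_gamma\<close> and \<open>eta_R_c\<close> below.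
\<close>

definition eta_L :: "'a :: comm_ring_1 lbuds \<Rightarrow> 'a lbuds poly" where
  "eta_L x = [:x:]"

lift_definition eta_R :: "'a :: comm_ring_1 lbuds \<Rightarrow> 'a lbuds poly"
  is "polynomial_eval (\<lambda>a. [:lbuds_const a:]) (\<lambda>x. [:lbuds_incl x, lbuds_const (dr_twist x):])"
proof -
  let ?h = "\<lambda>a :: 'a. [:lbuds_const a:]" and ?v = "\<lambda>x :: 'a Dr. [:lbuds_incl x, lbuds_const (dr_twist x):]"
  interpret scalar_hom ?h
    by standard (auto simp: one_pCons)
  fix p q :: "('a Dr \<Rightarrow>\<^sub>0 nat) \<Rightarrow>\<^sub>0 'a"
  assume "p - q \<in> ideal_span sym_relations"
  then have "polynomial_eval ?h ?v (p - q) = 0"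
  proof (rule eval_ideal)
    fix r :: "('a Dr \<Rightarrow>\<^sub>0 nat) \<Rightarrow>\<^sub>0 'a" assume "r \<in> sym_relations"
    then show "polynomial_eval ?h ?v r = 0"
      by (auto simp: sym_relations_def sym_var_def eval_diff eval_mult lbuds_incl_add lbuds_incl_scale)
  qed
  then show "polynomial_eval ?h ?v p = polynomial_eval ?h ?v q"
    by (simp add: eval_diff)
qed

lemma eta_R_hom:
  fixes x y :: "'a :: comm_ring_1 lbuds" and a :: 'a and d :: "'a Dr"
  shows "eta_R (0 :: 'a lbuds) = 0"
  "eta_R (1 :: 'a lbuds) = 1"
  "eta_R (x + y) = eta_R x + eta_R y"
  "eta_R (x * y) = eta_R x * eta_R y"
  "eta_R (lbuds_const a) = [:lbuds_const a:]"
  "eta_R (lbuds_incl d) = [:lbuds_incl d:] + [:0, lbuds_const (dr_twist d):]"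
proof -
  interpret scalar_hom "\<lambda>a :: 'a. [:lbuds_const a:]"
    by standard (auto simp: one_pCons)
  have surj: "\<exists>p. x = abs_lbuds p" for x :: "'a lbuds"
    using Quotient3_abs_rep[OF Quotient3_lbuds, of x] by metis
  obtain p q where xy: "x = abs_lbuds p" "y = abs_lbuds q"
    using surj by blast
  show "eta_R (0 :: 'a lbuds) = 0"
    unfolding zero_lbuds.abs_eq eta_R.abs_eq by (rule eval_zero)
  show "eta_R (1 :: 'a lbuds) = 1"
    unfolding one_lbuds.abs_eq eta_R.abs_eq by (rule eval_one)
  show "eta_R (x + y) = eta_R x + eta_R y"
    unfolding xy plus_lbuds.abs_eq eta_R.abs_eq by (rule eval_add)
  show "eta_R (x * y) = eta_R x * eta_R y"
    unfolding xy times_lbuds.abs_eq eta_R.abs_eq by (rule eval_mult)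
  show "eta_R (lbuds_const a) = [:lbuds_const a:]"
    by (subst lbuds_const.abs_eq) (simp add: eta_R.abs_eq)
  show "eta_R (lbuds_incl d) = [:lbuds_incl d:] + [:0, lbuds_const (dr_twist d):]"
    by (subst lbuds_incl_def) (simp add: eta_R.abs_eq sym_var_def)
qed

lemma eta_R_gamma:
  "eta_R (lbuds_incl dr_gamma) = [:lbuds_incl dr_gamma:] + 2 * [:0, 1:]"
  using lbuds_const_simps(3)[of "1 :: 'a" 1] by (simp add: eta_R_hom numeral_poly)

lemma eta_R_c:
  "eta_R (lbuds_incl (dr_c a)) = [:lbuds_incl (dr_c a):] + [:lbuds_const (a^2 - a):] * [:0, 1:]"
  by (simp add: eta_R_hom)

text \<open>
  The coproduct is the homomorphism of rings, and of algebras over the left copy of \<open>L\<close>, with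
  \<open>\<Delta>(t) = t \<otimes> 1 + 1 \<otimes> t\<close>, so that
  \<open>\<Delta>(\<Sum>\<^sub>k l\<^sub>k t\<^sup>k) = \<Sum>\<^sub>k \<Sum>\<^sub>j (k choose j) l\<^sub>k t\<^sup>j \<otimes> t\<^bsup>k-j\<^esup>\<close>. Its value is given by a representative
  in the free abelian group on pairs; passing to the tensor product over \<open>L\<close> is done by
  \<open>cobar_relations\<close>.
\<close>

definition comult :: "'a :: comm_ring_1 lbuds poly \<Rightarrow> ('a lbuds poly \<times> 'a lbuds poly) \<Rightarrow>\<^sub>0 int" where
  "comult p = (\<Sum>k | Polynomial.coeff p k \<noteq> 0. \<Sum>j\<le>k.
     frag_cmul (int (k choose j))
       (frag_of (Polynomial.monom (Polynomial.coeff p k) j, Polynomial.monom 1 (k - j))))"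

lemma comult_t:
  "comult [:0, 1 :: 'a :: comm_ring_1 lbuds:] = frag_of ([:0, 1:], 1) + frag_of (1, [:0, 1:])"
proof -
  have "Polynomial.coeff [:0, 1 :: 'a lbuds:] k \<noteq> 0 \<longleftrightarrow> k = 1" for k
    by (cases k) (simp_all add: coeff_pCons split: nat.splits)
  then show ?thesis
    by (simp add: comult_def monom_Suc monom_0 one_pCons)
qed

text \<open>
  Internal degrees: the elements of \<open>Dr\<^sup>A\<close> and \<open>t\<close> have degree \<open>2\<close>.
\<close>

definition lbuds_homogeneous :: "nat \<Rightarrow> 'a :: comm_ring_1 lbuds set" where
  "lbuds_homogeneous d = abs_lbuds `
     {p. \<forall>\<mu>\<in>Poly_Mapping.keys p. 2 * (\<Sum>x\<in>Poly_Mapping.keys \<mu>. Poly_Mapping.lookup \<mu> x) = d}"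

definition lbudsB_homogeneous :: "nat \<Rightarrow> 'a :: comm_ring_1 lbuds poly set" where
  "lbudsB_homogeneous d =
     {p. \<forall>i. Polynomial.coeff p i \<noteq> 0 \<longrightarrow>
            2 * i \<le> d \<and> Polynomial.coeff p i \<in> lbuds_homogeneous (d - 2 * i)}"


section \<open>The cobar complex\<close>

text \<open>
  For a Hopf algebroid \<open>(L, \<Gamma>)\<close> the (unreduced) cobar complex of the left comodule \<open>L\<close> is
  \<open>C\<^sup>s = \<Gamma> \<otimes>\<^sub>L \<dots> \<otimes>\<^sub>L \<Gamma> \<otimes>\<^sub>L L\<close> with \<open>s\<close> factors \<open>\<Gamma>\<close>, where the right \<open>L\<close>-action on
  \<open>\<Gamma>\<close> is through the right unit and the left \<open>L\<close>-action through the left unit, and the comodule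
  structure map of \<open>L\<close> is the left unit. The word \<open>(w, m)\<close> stands for
  \<open>w\<^sub>1 \<otimes> \<dots> \<otimes> w\<^sub>s \<otimes> m\<close>. The counit and the antipode do not enter.
\<close>

record ('l, 'b) graded_hopf_algebroid =
  left_unit :: "'l \<Rightarrow> 'b"
  right_unit :: "'l \<Rightarrow> 'b"
  coproduct :: "'b \<Rightarrow> ('b \<times> 'b) \<Rightarrow>\<^sub>0 int"
  base_degree :: "nat \<Rightarrow> 'l set"
  total_degree :: "nat \<Rightarrow> 'b set"

definition lbuds_hopf_algebroid :: "('a :: comm_ring_1 lbuds, 'a lbuds poly) graded_hopf_algebroid" where
  "lbuds_hopf_algebroid =
     \<lparr>left_unit = eta_L, right_unit = eta_R, coproduct = comult,
      base_degree = lbuds_homogeneous, total_degree = lbudsB_homogeneous\<rparr>"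

text \<open>
  The subgroup by which the free abelian group on words has to be divided to obtain the tensor
  products of all lengths at once; every generator is homogeneous in the length of the words.
\<close>

definition cobar_relations ::
    "('l :: comm_ring_1, 'b :: comm_ring_1) graded_hopf_algebroid \<Rightarrow> (('b list \<times> 'l) \<Rightarrow>\<^sub>0 int) set" where
  "cobar_relations H = generate (free_Abelian_group UNIV)
     ({frag_of (u @ [x + y] @ v, m) - frag_of (u @ [x] @ v, m) - frag_of (u @ [y] @ v, m) | u x y v m. True}
    \<union> {frag_of (u, m + m') - frag_of (u, m) - frag_of (u, m') | u m m'. True}
    \<union> {frag_of (u @ [x * right_unit H l, y] @ v, m) - frag_of (u @ [x, left_unit H l * y] @ v, m)
        | u x l y v m. True}
    \<union> {frag_of (u @ [x * right_unit H l], m) - frag_of (u @ [x], l * m) | u x l m. True})"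

text \<open>
  \<open>d(w\<^sub>1 \<otimes> \<dots> \<otimes> w\<^sub>s \<otimes> m) = 1 \<otimes> w\<^sub>1 \<otimes> \<dots> \<otimes> m + \<Sum>\<^sub>i (-1)\<^sup>i \<dots> \<otimes> \<Delta>(w\<^sub>i) \<otimes> \<dots> + (-1)\<^bsup>s+1\<^esup> w\<^sub>1 \<otimes> \<dots> \<otimes> w\<^sub>s \<otimes> \<eta>\<^sub>L(m) \<otimes> 1\<close>,
  with \<open>i\<close> counted from \<open>0\<close> in the code.
\<close>

definition cobar_differential ::
    "('l :: comm_ring_1, 'b :: comm_ring_1) graded_hopf_algebroid \<Rightarrow>
       (('b list \<times> 'l) \<Rightarrow>\<^sub>0 int) \<Rightarrow> ('b list \<times> 'l) \<Rightarrow>\<^sub>0 int" where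
  "cobar_differential H = frag_extend (\<lambda>(w, m).
     frag_of ([1] @ w, m)
   + (\<Sum>i<length w. frag_cmul ((-1) ^ (i + 1))
        (frag_extend (\<lambda>(x, y). frag_of (take i w @ [x, y] @ drop (i + 1) w, m)) (coproduct H (w ! i))))
   + frag_cmul ((-1) ^ (length w + 1)) (frag_of (w @ [left_unit H m], 1)))"

text \<open>
  \<open>cobar_chains H s d\<close> consists of representatives of the elements of \<open>C\<^sup>s\<close> of internal degree \<open>d\<close>.
  Cocycles and coboundaries are likewise sets of representatives: equality in \<open>C\<^sup>s\<close> is
  congruence modulo \<open>cobar_relations\<close>, and the coboundaries include the representatives of \<open>0\<close>.
\<close>

definition cobar_chains ::
    "('l, 'b) graded_hopf_algebroid \<Rightarrow> nat \<Rightarrow> nat \<Rightarrow> (('b list \<times> 'l) \<Rightarrow>\<^sub>0 int) monoid" where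
  "cobar_chains H s d = free_Abelian_group
     {(w, m). length w = s \<and>
        (\<exists>es e. list_all2 (\<lambda>x k. x \<in> total_degree H k) w es \<and> m \<in> base_degree H e \<and> sum_list es + e = d)}"

definition cobar_cocycles ::
    "('l :: comm_ring_1, 'b :: comm_ring_1) graded_hopf_algebroid \<Rightarrow> nat \<Rightarrow> nat \<Rightarrow> (('b list \<times> 'l) \<Rightarrow>\<^sub>0 int) set" where
  "cobar_cocycles H s d = {z \<in> carrier (cobar_chains H s d). cobar_differential H z \<in> cobar_relations H}"

definition cobar_coboundaries ::
    "('l :: comm_ring_1, 'b :: comm_ring_1) graded_hopf_algebroid \<Rightarrow> nat \<Rightarrow> nat \<Rightarrow> (('b list \<times> 'l) \<Rightarrow>\<^sub>0 int) set" where
  "cobar_coboundaries H s d = {z \<in> carrier (cobar_chains H s d).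
     \<exists>y \<in> (case s of 0 \<Rightarrow> {0} | Suc r \<Rightarrow> carrier (cobar_chains H r d)).
       z - cobar_differential H y \<in> cobar_relations H}"

definition Cotor ::
    "('l :: comm_ring_1, 'b :: comm_ring_1) graded_hopf_algebroid \<Rightarrow> nat \<Rightarrow> nat \<Rightarrow>
       (('b list \<times> 'l) \<Rightarrow>\<^sub>0 int) set monoid" where
  "Cotor H s d = (cobar_chains H s d)\<lparr>carrier := cobar_cocycles H s d\<rparr> Mod cobar_coboundaries H s d"

text \<open>
  \<open>H\<^sup>s\<close> of the stack of formal \<open>A\<close>-module 2-buds with coefficients in the \<open>n\<close>-th tensor power of
  \<open>\<omega>\<close>.
\<close>

definition flat_cohomology_omega ::
    "'a :: comm_ring_1 itself \<Rightarrow> nat \<Rightarrow> nat \<Rightarrow> (('a lbuds poly list \<times> 'a lbuds) \<Rightarrow>\<^sub>0 int) set monoid" where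
  "flat_cohomology_omega _ s n = Cotor lbuds_hopf_algebroid s (2 * n)"


section \<open>Points and the zeta function\<close>

definition F2_points :: "('a :: comm_ring_1 \<Rightarrow> bit) set" where
  "F2_points = ring_hom (ring_of_type_algebra :: 'a ring) (ring_of_type_algebra :: bit ring)"

text \<open>
  The field with \<open>2\<^sup>m\<close> elements as the fixed field of the \<open>m\<close>-th power of Frobenius in an
  algebraic closure of the field with two elements.
\<close>

definition finite_field_2 :: "nat \<Rightarrow> bit alg_closure ring" where
  "finite_field_2 m = ring_of_type_algebra\<lparr>carrier := {x. x ^ (2 ^ m) = x}\<rparr>"

definition num_points :: "'a :: comm_ring_1 itself \<Rightarrow> nat \<Rightarrow> nat" where
  "num_points _ m = card (ring_hom (ring_of_type_algebra :: 'a ring) (finite_field_2 m))"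

definition zeta_2 :: "'a :: comm_ring_1 itself \<Rightarrow> rat fps" where
  "zeta_2 A = fps_exp 1 oo Abs_fps (\<lambda>m. if m = 0 then 0 else of_nat (num_points A m) / of_nat m)"

end

theory Submission
  imports Defs
begin

text \<open>
  In internal degree \<open>2\<close> the cobar complex is \<open>Dr\<^sup>A \<rightarrow> Dr\<^sup>A \<oplus> A t \<rightarrow> Dr\<^sup>A \<oplus> A t\<^sub>1 \<oplus> A t\<^sub>2\<close>. With
  \<open>\<tau>\<close> the linear map \<open>\<gamma> \<mapsto> 2\<close>, \<open>c\<^sub>a \<mapsto> a\<^sup>2 - a\<close>, the differentials are \<open>x \<mapsto> \<tau> x \<cdot> t\<close> and
  \<open>x + a t \<mapsto> x + \<tau> x \<cdot> t\<^sub>1\<close>. Hence the cocycles are \<open>A t\<close> and the first cohomology group is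
  \<open>A / I\<close> for the ideal \<open>I\<close> generated by \<open>2\<close> and all \<open>a\<^sup>2 - a\<close>. This is a Noetherian Boolean ring, so
  it is the finite product of its residue fields, which are indexed by the homomorphisms from
  \<open>A\<close> to the field with two elements.
\<close>

section \<open>Points over the field with two elements\<close>

text \<open>Two obstacles shape the proof. An equation in C^s means membership in a subgroup of the
  free abelian group on words of all lengths, and that subgroup is given by generators, not by
  equations. Equations come from the fact that \<Gamma> is free over the left copy of L on the
  powers of t: additive invariants with values in polynomial rings kill every relation, and
  reduction to a normal form shows that on words of the length in question they kill nothing else.
  The other obstacle is the count of A / I. The quotient ring is never formed; a class is recorded
  by the set of points at which its scalar takes the value 1, so the order appears directly as the
  number of subsets. This requires that vanishing at all points implies membership in I, and that
  every set of points is cut out by an element. For the latter the Noetherian hypothesis is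
  decisive: the kernel of a point is finitely generated, so a finite product isolates the point, and
  this in turn forces the number of points to be finite.\<close>

lemma ring_of_type_algebra_simps [simp]:
  "carrier (ring_of_type_algebra :: 'a :: comm_ring_1 ring) = UNIV"
  "monoid.mult (ring_of_type_algebra :: 'a ring) = (*)"
  "one (ring_of_type_algebra :: 'a ring) = 1"
  "ring.zero (ring_of_type_algebra :: 'a ring) = 0"
  "add (ring_of_type_algebra :: 'a ring) = (+)"
  by (simp_all add: ring_of_type_algebra_def)

lemma a_inv_ring_of_type_algebra:
  "a_inv (ring_of_type_algebra :: 'a :: comm_ring_1 ring) x = - x"
proof -
  interpret cring "ring_of_type_algebra :: 'a ring" by (rule cring_from_type_algebra)
  show ?thesis by (rule minus_equality) simp_all
qed

text \<open>Closure under negation follows from multiplication by -1, so ideals can be handled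
  purely in type class arithmetic.\<close>

lemma ideal_of_type_algebra_iff:
  "ideal J (ring_of_type_algebra :: 'a :: comm_ring_1 ring) \<longleftrightarrow>
     0 \<in> J \<and> (\<forall>x\<in>J. \<forall>y\<in>J. x + y \<in> J) \<and> (\<forall>x\<in>J. \<forall>r. r * x \<in> J)" (is "?l \<longleftrightarrow> ?r")
proof
  assume ?l
  then interpret ideal J "ring_of_type_algebra :: 'a ring" .
  show ?r using additive_subgroup.zero_closed[OF is_additive_subgroup]
      additive_subgroup.a_closed[OF is_additive_subgroup] I_l_closed by simp
next
  assume r: ?r
  interpret cring "ring_of_type_algebra :: 'a ring" by (rule cring_from_type_algebra)
  show ?l
  proof (rule idealI)
    show "subgroup J (add_monoid (ring_of_type_algebra :: 'a ring))"
    proof (rule add.subgroupI)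
      show "\<ominus>\<^bsub>ring_of_type_algebra\<^esub> a \<in> J" if "a \<in> J" for a
        using r that a_inv_ring_of_type_algebra[of a] by (metis mult_minus1)
    qed (use r in auto)
  qed (use r in \<open>auto simp: mult.commute ring_axioms\<close>)
qed

section \<open>Points over F_2 and their kernels\<close>

lemma F2_points_iff:
  "f \<in> (F2_points :: ('a :: comm_ring_1 \<Rightarrow> bit) set) \<longleftrightarrow>
     (\<forall>x y. f (x + y) = f x + f y) \<and> (\<forall>x y. f (x * y) = f x * f y) \<and> f 1 = 1"
  unfolding F2_points_def ring_hom_def by (simp only: ring_of_type_algebra_simps) blast

lemma F2_pointsD:
  assumes "f \<in> (F2_points :: ('a :: comm_ring_1 \<Rightarrow> bit) set)"
  shows "f (x + y) = f x + f y" "f (x * y) = f x * f y" "f 1 = 1" "f 0 = 0"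
    "f (- x) = f x" "f (x - y) = f x + f y"
    "f (sum g Y) = (\<Sum>i\<in>Y. f (g i))" "f (prod g Y) = (\<Prod>i\<in>Y. f (g i))"
proof -
  show a: "f (x + y) = f x + f y" "f (x * y) = f x * f y" "f 1 = 1" for x y
    using assms by (auto simp: F2_points_iff)
  show z: "f 0 = 0" using a(1)[of 0 0] by simp
  show m: "f (- x) = f x" for x using a(1)[of x "- x"] z
    by (cases "f x"; cases "f (- x)") auto
  show "f (x - y) = f x + f y" using a(1)[of x "- y"] m by simp
  show "f (sum g Y) = (\<Sum>i\<in>Y. f (g i))" by (induction Y rule: infinite_finite_induct) (auto simp: a z)
  show "f (prod g Y) = (\<Prod>i\<in>Y. f (g i))" by (induction Y rule: infinite_finite_induct) (auto simp: a z)
qed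

lemma ideal_F2_kernel:
  assumes "f \<in> (F2_points :: ('a :: comm_ring_1 \<Rightarrow> bit) set)"
  shows "ideal {x. f x = 0} (ring_of_type_algebra :: 'a ring)"
  using assms by (auto simp: ideal_of_type_algebra_iff F2_pointsD)

text \<open>Inclusion of kernels suffices because \<open>f x = 1\<close> puts \<open>x - 1\<close>
  into the kernel of \<open>f\<close>.\<close>

lemma F2_points_eqI:
  assumes "f \<in> F2_points" "g \<in> F2_points" "\<And>x. f x = 0 \<Longrightarrow> g x = 0"
  shows "f = g"
proof
  fix x show "f x = g x"
  proof (cases "f x = 0")
    case False
    then have "f (x - 1) = 0" using assms(1) by (simp add: F2_pointsD)
    then have "g (x - 1) = 0" by (rule assms(3))
    with False show ?thesis using assms(2) by (cases "g x") (auto simp: F2_pointsD)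
  qed (use assms in auto)
qed

text \<open>An ideal maximal among those that contain \<open>J\<close> and avoid \<open>a\<close>
  has residue field F_2, because every element of the quotient is idempotent; the point is reduction
  modulo that ideal.\<close>

lemma exists_F2_point_avoiding:
  fixes J :: "'a :: comm_ring_1 set"
  assumes noeth: "noetherian_ring (ring_of_type_algebra :: 'a ring)"
    and J: "ideal J (ring_of_type_algebra :: 'a ring)" and a: "a \<notin> J"
    and boolean: "\<And>x. x^2 - x \<in> J"
  obtains f where "f \<in> F2_points" "\<And>x. x \<in> J \<Longrightarrow> f x = 0" "f a = 1"
proof -
  let ?R = "ring_of_type_algebra :: 'a ring"
  interpret noetherian_ring ?R by (rule noeth)
  let ?P = "{M. ideal M ?R \<and> J \<subseteq> M \<and> a \<notin> M}"
  have "\<exists>M\<in>?P. \<forall>Y\<in>?P. M \<subseteq> Y \<longrightarrow> Y = M"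
  proof (rule subset_Zorn_nonempty)
    show "?P \<noteq> {}" using J a by auto
    fix C assume C: "C \<noteq> {}" "subset.chain ?P C"
    then have "subset.chain {I. ideal I ?R} C" by (auto simp: pred_on.chain_def)
    \<comment> \<open>In a Noetherian ring the union of a nonempty chain of ideals is a member of
      the chain.\<close>
    from ideal_chain_is_trivial[OF C(1) this] C(2) show "\<Union>C \<in> ?P"
      by (auto simp: pred_on.chain_def)
  qed
  then obtain M where M: "ideal M ?R" "J \<subseteq> M" "a \<notin> M"
    and max: "\<And>Y. ideal Y ?R \<Longrightarrow> J \<subseteq> Y \<Longrightarrow> a \<notin> Y \<Longrightarrow> M \<subseteq> Y \<Longrightarrow> Y = M" by auto
  have Mz: "0 \<in> M" and Ma: "\<And>x y. x \<in> M \<Longrightarrow> y \<in> M \<Longrightarrow> x + y \<in> M"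
    and Mm: "\<And>x r. x \<in> M \<Longrightarrow> r * x \<in> M" using M(1) by (auto simp: ideal_of_type_algebra_iff)
  have Md: "x - y \<in> M" if "x \<in> M" "y \<in> M" for x y
    using Ma[OF that(1) Mm[OF that(2), of "-1"]] by simp
  have Mb: "x^2 - x \<in> M" for x using boolean M(2) by auto
  \<comment> \<open>Maximality applied to the ideal generated by \<open>M\<close> and
    \<open>b\<close>, which must therefore contain \<open>a\<close>.\<close>
  have adjoin: "\<exists>m\<in>M. \<exists>r. a = m + r * b" if b: "b \<notin> M" for b
  proof (rule ccontr)
    assume no: "\<not> ?thesis"
    let ?Y = "{m + r * b | m r. m \<in> M}"
    have "ideal ?Y ?R" unfolding ideal_of_type_algebra_iff
    proof (intro conjI ballI allI)
      show "0 \<in> ?Y" using Mz by (auto intro!: exI[of _ 0])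
    next
      fix x y assume "x \<in> ?Y" "y \<in> ?Y"
      then obtain m r n s where xy: "x = m + r * b" "y = n + s * b" "m \<in> M" "n \<in> M" by auto
      then have "x + y = (m + n) + (r + s) * b" by (simp add: algebra_simps)
      then show "x + y \<in> ?Y" using Ma xy by blast
    next
      fix x s assume "x \<in> ?Y"
      then obtain m r where x: "x = m + r * b" "m \<in> M" by auto
      then have "s * x = s * m + (s * r) * b" by (simp add: algebra_simps)
      then show "s * x \<in> ?Y" using Mm x by blast
    qed
    moreover have "M \<subseteq> ?Y"
    proof
      fix x assume "x \<in> M"
      moreover have "x = x + 0 * b" by simp
      ultimately show "x \<in> ?Y" by blast
    qed
    ultimately have "?Y = M" using max[of ?Y] M(2) no by auto
    moreover have "b = 0 + 1 * b" by simp
    then have "b \<in> ?Y" using Mz by blast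
    ultimately show False using b by simp
  qed
  have dich: "b \<in> M \<or> 1 - b \<in> M" for b
  proof (rule ccontr)
    assume "\<not> ?thesis"
    with adjoin obtain m r n s where
      *: "m \<in> M" "n \<in> M" "a = m + r * b" "a = n + s * (1 - b)" by metis
    \<comment> \<open>Multiply the two expressions for \<open>a\<close>: the only product without a
      factor in \<open>M\<close> is \<open>(r * b) * (s * (1 - b))\<close>, a multiple of
      \<open>b^2 - b\<close>, and \<open>a\<close> differs from its square by an element of
      \<open>M\<close>.\<close>
    have "a = a * a - (a^2 - a)" by (simp add: power2_eq_square)
    also have "\<dots> = a * m + (r * b) * n - (r * s) * (b^2 - b) - (a^2 - a)"
    proof -
      have "a * a = a * m + (r * b) * a" using *(3) by (metis distrib_left mult.commute)
      also have "(r * b) * a = (r * b) * n - (r * s) * (b^2 - b)"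
        unfolding *(4) by (simp add: algebra_simps power2_eq_square)
      finally show ?thesis by simp
    qed
    also have "\<dots> \<in> M" by (intro Md Ma Mm * Mb)
    finally show False using M(3) by simp
  qed
  have one: "1 \<notin> M" using Mm[of 1 a] M(3) by auto
  have neg: "1 - b \<notin> M" if "b \<in> M" for b using Ma[OF that, of "1 - b"] one by auto
  define f :: "'a \<Rightarrow> bit" where "f b = (if b \<in> M then 0 else 1)" for b
  have mult: "x * y \<in> M \<longleftrightarrow> x \<in> M \<or> y \<in> M" for x y
  proof
    assume xy: "x * y \<in> M"
    show "x \<in> M \<or> y \<in> M"
    proof (rule ccontr)
      assume "\<not> ?thesis"
      then have "y * (1 - x) \<in> M" "1 - y \<in> M" using dich Mm by auto
      from Ma[OF xy Ma[OF this]] one show False by (simp add: algebra_simps)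
    qed
  qed (use Mm in \<open>metis mult.commute\<close>)
  \<comment> \<open>2 is itself of the form \<open>x^2 - x\<close>, with
    \<open>x = 2\<close>.\<close>
  have two: "2 \<in> M" using Mb[of 2] by (simp add: power2_eq_square)
  have add: "x + y \<in> M \<longleftrightarrow> (x \<in> M \<longleftrightarrow> y \<in> M)" for x y
  proof (cases "x \<in> M")
    case True
    then show ?thesis using Ma[OF True] Md[of "x + y" x] by auto
  next
    case False
    then have x: "1 - x \<in> M" using dich by auto
    show ?thesis
    proof (cases "y \<in> M")
      case True
      then show ?thesis using False Md[of "x + y" y] by auto
    next
      case y: False
      then have "1 - y \<in> M" using dich by auto
      \<comment> \<open>\<open>x + y = 2 - ((1 - x) + (1 - y))\<close>, so two elements outside
        \<open>M\<close> have their sum inside.\<close>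
      from Md[OF two Ma[OF x this]] show ?thesis using False y by simp
    qed
  qed
  have "f \<in> F2_points"
    unfolding F2_points_iff f_def using mult add one by auto
  then show ?thesis
    by (rule that) (use M in \<open>auto simp: f_def\<close>)
qed

text \<open>The kernel of \<open>f\<close> has finitely many generators. The product of all
  \<open>1 - x\<close> takes the value 1 at \<open>g\<close> exactly when \<open>g\<close> kills
  every generator \<open>x\<close>; then the kernel of \<open>f\<close> lies in that of
  \<open>g\<close>, which forces \<open>g = f\<close>.\<close>

lemma exists_F2_indicator:
  fixes f :: "'a :: comm_ring_1 \<Rightarrow> bit"
  assumes noeth: "noetherian_ring (ring_of_type_algebra :: 'a ring)" and f: "f \<in> F2_points"
  obtains u where "\<And>g. g \<in> F2_points \<Longrightarrow> g u = (if g = f then 1 else 0)"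
proof -
  let ?R = "ring_of_type_algebra :: 'a ring"
  interpret noetherian_ring ?R by (rule noeth)
  obtain E where E: "finite E" "{x. f x = 0} = Idl\<^bsub>?R\<^esub> E"
    using finetely_gen[OF ideal_F2_kernel[OF f]] by blast
  show ?thesis
  proof (rule that[of "\<Prod>x\<in>E. 1 - x"])
    fix g :: "'a \<Rightarrow> bit" assume g: "g \<in> F2_points"
    have EE: "E \<subseteq> Idl\<^bsub>?R\<^esub> E" by (rule genideal_self) simp
    have v: "g (\<Prod>x\<in>E. 1 - x) = (\<Prod>x\<in>E. 1 + g x)" using g by (simp add: F2_pointsD)
    show "g (\<Prod>x\<in>E. 1 - x) = (if g = f then 1 else 0)"
    proof (cases "\<forall>x\<in>E. g x = 0")
      case True
      then have "Idl\<^bsub>?R\<^esub> E \<subseteq> {x. g x = 0}"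
        by (intro genideal_minimal ideal_F2_kernel g) auto
      then have "f = g" using E(2) by (intro F2_points_eqI f g) auto
      with True show ?thesis unfolding v by simp
    next
      case False
      then obtain x where x: "x \<in> E" "g x = 1" by (metis bit_not_zero_iff)
      moreover from x(1) EE E(2) have "f x = 0" by auto
      ultimately have "g \<noteq> f" by auto
      moreover have "(\<Prod>x\<in>E. 1 + g x) = 0" using x E(1) by (auto intro!: prod_zero)
      ultimately show ?thesis unfolding v by simp
    qed
  qed
qed

text \<open>With infinitely many points, the elements that are nonzero at only finitely many of them
  would form a proper ideal with Boolean quotient. Some point \<open>f\<close> would kill this
  ideal, yet the indicator of \<open>f\<close> lies in it.\<close>

lemma finite_F2_points:
  assumes noeth: "noetherian_ring (ring_of_type_algebra :: 'a :: comm_ring_1 ring)"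
  shows "finite (F2_points :: ('a \<Rightarrow> bit) set)"
proof (rule ccontr)
  let ?F = "F2_points :: ('a \<Rightarrow> bit) set"
  assume inf: "infinite ?F"
  let ?K = "{a :: 'a. finite {f \<in> ?F. f a \<noteq> 0}}"
  have K: "ideal ?K ring_of_type_algebra"
    unfolding ideal_of_type_algebra_iff
  proof (intro conjI ballI allI)
    show "0 \<in> ?K" by (simp add: F2_pointsD cong: conj_cong)
    fix x assume x: "x \<in> ?K"
    show "x + y \<in> ?K" if "y \<in> ?K" for y
    proof -
      have "{f \<in> ?F. f (x + y) \<noteq> 0} \<subseteq> {f \<in> ?F. f x \<noteq> 0} \<union> {f \<in> ?F. f y \<noteq> 0}"
        by (auto simp: F2_pointsD)
      with x that show ?thesis by (auto intro: finite_subset)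
    qed
    show "r * x \<in> ?K" for r
    proof -
      have "{f \<in> ?F. f (r * x) \<noteq> 0} \<subseteq> {f \<in> ?F. f x \<noteq> 0}" by (auto simp: F2_pointsD)
      with x show ?thesis by (auto intro: finite_subset)
    qed
  qed
  have one: "1 \<notin> ?K" using inf by (simp add: F2_pointsD cong: conj_cong)
  have bool: "x^2 - x \<in> ?K" for x
  proof -
    have "{f \<in> ?F. f (x^2 - x) \<noteq> 0} = {}" by (auto simp: F2_pointsD power2_eq_square)
    then show ?thesis by (metis (mono_tags) finite.emptyI mem_Collect_eq)
  qed
  obtain f where f: "f \<in> ?F" "\<And>x. x \<in> ?K \<Longrightarrow> f x = 0"
    by (rule exists_F2_point_avoiding[OF noeth K one bool]) blast
  obtain u where u: "\<And>g. g \<in> ?F \<Longrightarrow> g u = (if g = f then 1 else 0)"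
    by (rule exists_F2_indicator[OF noeth f(1)]) blast
  have "{g \<in> ?F. g u \<noteq> 0} \<subseteq> {f}" using u by (metis (mono_tags, lifting) insertI1 mem_Collect_eq subsetI)
  then have "u \<in> ?K" by (auto intro: finite_subset)
  from f(2)[OF this] u[OF f(1)] show False by simp
qed

text \<open>The sum of the indicators of the members of \<open>S\<close> does it, \<open>S\<close>
  being finite.\<close>

lemma F2_points_separated:
  assumes noeth: "noetherian_ring (ring_of_type_algebra :: 'a :: comm_ring_1 ring)"
    and S: "S \<subseteq> (F2_points :: ('a \<Rightarrow> bit) set)"
  obtains a where "{f \<in> F2_points. f a = 1} = S"
proof -
  have fin: "finite S" using finite_F2_points[OF noeth] S by (rule finite_subset[rotated])
  have "\<forall>f\<in>S. \<exists>u. \<forall>g\<in>F2_points. g u = (if g = f then 1 else 0)"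
    using exists_F2_indicator[OF noeth] S by (metis subsetD)
  then obtain u where u: "\<And>f g. f \<in> S \<Longrightarrow> g \<in> F2_points \<Longrightarrow> g (u f) = (if g = f then 1 else 0)"
    by metis
  have val: "g (\<Sum>f\<in>S. u f) = (if g \<in> S then 1 else 0)" if g: "g \<in> F2_points" for g
  proof -
    have "g (\<Sum>f\<in>S. u f) = (\<Sum>f\<in>S. if g = f then 1 else 0)"
      using g by (simp add: F2_pointsD u)
    also have "\<dots> = (if g \<in> S then 1 else 0)" using fin by (simp add: sum.delta)
    finally show ?thesis .
  qed
  have "g \<in> F2_points \<and> g (\<Sum>f\<in>S. u f) = 1 \<longleftrightarrow> g \<in> S" for g
    using val[of g] S by (cases "g \<in> S") auto
  then have "{f \<in> F2_points. f (\<Sum>f\<in>S. u f) = 1} = S" by blast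
  then show ?thesis by (rule that)
qed

text \<open>The range is the ideal generated by 2 and all \<open>b^2 - b\<close>. Points kill these
  generators; conversely the quotient is Boolean, so an element outside the ideal is detected by a
  point.\<close>

lemma range_dr_twist_iff:
  fixes a :: "'a :: comm_ring_1"
  assumes noeth: "noetherian_ring (ring_of_type_algebra :: 'a ring)"
  shows "a \<in> range dr_twist \<longleftrightarrow> (\<forall>f\<in>F2_points. f a = 0)"
proof
  assume "a \<in> range dr_twist"
  then obtain x where "a = dr_twist x" by blast
  moreover have "abs_Dr (rep_Dr x) = x" by (rule Quotient3_abs_rep[OF Quotient3_Dr])
  ultimately obtain p where p: "a = dr_twist (abs_Dr p)" by metis
  show "\<forall>f\<in>F2_points. f a = 0"
  proof
    fix f :: "'a \<Rightarrow> bit" assume f: "f \<in> F2_points"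
    have "f (case s of Sym_gamma \<Rightarrow> 2 | Sym_c b \<Rightarrow> b^2 - b) = 0" for s
      using F2_pointsD(1)[OF f, of 1 1]
      by (cases s) (auto simp: F2_pointsD[OF f] power2_eq_square)
    then show "f a = 0"
      unfolding p dr_twist.abs_eq linear_extension_def by (simp add: F2_pointsD[OF f])
  qed
next
  assume *: "\<forall>f\<in>F2_points. f a = 0"
  have I: "ideal (range (dr_twist :: 'a Dr \<Rightarrow> 'a)) (ring_of_type_algebra :: 'a ring)"
    unfolding ideal_of_type_algebra_iff
  proof (intro conjI ballI allI)
    show "0 \<in> range (dr_twist :: 'a Dr \<Rightarrow> 'a)" using rangeI[of dr_twist "dr_scale 0 (dr_gamma :: 'a Dr)"] by simp
  next
    fix x y :: 'a assume "x \<in> range dr_twist" "y \<in> range dr_twist"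
    then show "x + y \<in> range dr_twist" by (auto simp flip: dr_twist_simps(3))
  next
    fix x r :: 'a assume "x \<in> range dr_twist"
    then show "r * x \<in> range dr_twist" by (auto simp flip: dr_twist_simps(4))
  qed
  have B: "x^2 - x \<in> range (dr_twist :: 'a Dr \<Rightarrow> 'a)" for x :: 'a
    using rangeI[of dr_twist "dr_c x"] by simp
  show "a \<in> range dr_twist"
  proof (rule ccontr)
    assume "a \<notin> range dr_twist"
    then obtain f where "f \<in> F2_points" "f a = 1"
      using exists_F2_point_avoiding[OF noeth I _ B] by metis
    with * show False by (metis zero_neq_one)
  qed
qed

section \<open>The point count in the zeta function\<close>

lemma num_points_1: "num_points TYPE('a :: comm_ring_1) 1 = card (F2_points :: ('a \<Rightarrow> bit) set)"
proof -
  let ?H = "ring_hom (ring_of_type_algebra :: 'a ring) (finite_field_2 1)"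
  have H: "h \<in> ?H \<longleftrightarrow> (\<forall>x. h x ^ 2 = h x) \<and> (\<forall>x y. h (x + y) = h x + h y) \<and>
      (\<forall>x y. h (x * y) = h x * h y) \<and> h 1 = 1" for h
    by (auto simp: finite_field_2_def ring_hom_def)
  \<comment> \<open>The field fixed by Frobenius consists of the roots of x (x - 1), so maps into it
    come from \<open>bit\<close> through \<open>to_ac\<close>.\<close>
  have cases: "x = 0 \<or> x = 1" if "x ^ 2 = x" for x :: "bit alg_closure"
    using that by (simp add: power2_eq_square)
  have "bij_betw (\<lambda>f. to_ac \<circ> f) (F2_points :: ('a \<Rightarrow> bit) set) ?H"
  proof (rule bij_betwI')
    fix f g :: "'a \<Rightarrow> bit"
    show "(to_ac \<circ> f = to_ac \<circ> g) = (f = g)" by (auto simp: fun_eq_iff)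
    assume f: "f \<in> F2_points"
    have "to_ac (f x) ^ 2 = to_ac (f x)" for x by (cases "f x") simp_all
    then show "to_ac \<circ> f \<in> ?H"
      unfolding H comp_apply F2_pointsD(1-3)[OF f] to_ac_add to_ac_mult to_ac_1 by blast
  next
    fix h assume h: "h \<in> ?H"
    define f :: "'a \<Rightarrow> bit" where "f x = (if h x = 0 then 0 else 1)" for x
    have hf: "h x = to_ac (f x)" for x using h cases[of "h x"] unfolding H f_def by auto
    have "to_ac (f (x + y)) = to_ac (f x + f y)" "to_ac (f (x * y)) = to_ac (f x * f y)"
      "to_ac (f 1) = to_ac 1" for x y
      using h unfolding to_ac_add to_ac_mult to_ac_1 hf[symmetric] H by blast+
    then have "f \<in> F2_points" unfolding F2_points_iff to_ac_eq_iff by blast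
    then show "\<exists>f\<in>F2_points. h = to_ac \<circ> f" using hf by (intro bexI[of _ f]) auto
  qed
  then show ?thesis unfolding num_points_def by (metis bij_betw_same_card)
qed

text \<open>The chain rule gives Z' = Z P' for Z the exponential of P, and the constant term of P'
  is N_1; Z starts with 1 and can be cancelled.\<close>

lemma zeta_2_log_deriv_0:
  "fps_nth (fps_deriv (zeta_2 A) / zeta_2 A) 0 = of_nat (num_points A 1)"
proof -
  let ?P = "Abs_fps (\<lambda>m. if m = 0 then 0 else of_nat (num_points A m) / of_nat m) :: rat fps"
  have P0: "fps_nth ?P 0 = 0" by simp
  have z0: "fps_nth (zeta_2 A) 0 = 1" by (simp add: zeta_2_def)
  have "fps_deriv (zeta_2 A) = zeta_2 A * fps_deriv ?P"
    unfolding zeta_2_def by (subst fps_compose_deriv[OF P0]) simp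
  moreover have "zeta_2 A \<noteq> 0" using z0 by auto
  ultimately have "fps_deriv (zeta_2 A) / zeta_2 A = fps_deriv ?P" by simp
  then show ?thesis by simp
qed

section \<open>Maps out of free modules and polynomial rings\<close>

lemma poly_mapping_sum_single:
  "p = (\<Sum>k\<in>Poly_Mapping.keys p. Poly_Mapping.single k (Poly_Mapping.lookup p k))"
  by (rule poly_mapping_eqI) (auto simp: lookup_sum lookup_single when_def in_keys_iff)

lemma poly_mapping_single_add_induct [case_names single add]:
  fixes p :: "'k \<Rightarrow>\<^sub>0 'v :: comm_monoid_add"
  assumes single: "\<And>k v. P (Poly_Mapping.single k v)"
    and add: "\<And>p q. P p \<Longrightarrow> P q \<Longrightarrow> P (p + q)"
  shows "P p"
proof -
  \<comment> \<open>\<open>single[of undefined 0]\<close> is the claim for the zero mapping, which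
    serves the empty sum.\<close>
  have "P (\<Sum>k\<in>S. Poly_Mapping.single k (Poly_Mapping.lookup p k))" for S
    using single[of undefined 0] by (induction S rule: infinite_finite_induct) (auto intro: single add)
  then show ?thesis by (metis poly_mapping_sum_single)
qed

text \<open>The homomorphism from the free abelian group that extends \<open>f\<close>; the
  counterpart of \<open>frag_extend\<close> with values in a ring.\<close>

definition frag_hom :: "('w \<Rightarrow> 'b :: comm_ring_1) \<Rightarrow> ('w \<Rightarrow>\<^sub>0 int) \<Rightarrow> 'b" where
  "frag_hom f z = (\<Sum>w\<in>Poly_Mapping.keys z. of_int (Poly_Mapping.lookup z w) * f w)"

lemma frag_hom_superset:
  "finite S \<Longrightarrow> Poly_Mapping.keys z \<subseteq> S \<Longrightarrow> frag_hom f z = (\<Sum>w\<in>S. of_int (Poly_Mapping.lookup z w) * f w)"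
  unfolding frag_hom_def by (rule sum.mono_neutral_left) (auto simp: in_keys_iff)

lemma frag_hom_zero [simp]: "frag_hom f 0 = 0"
  by (simp add: frag_hom_def)

lemma frag_hom_of [simp]: "frag_hom f (frag_of w) = f w"
  by (simp add: frag_hom_def)

lemma frag_hom_add: "frag_hom f (x + y) = frag_hom f x + frag_hom f y"
  using Poly_Mapping.keys_add[of x y]
  by (simp add: frag_hom_superset[of "Poly_Mapping.keys x \<union> Poly_Mapping.keys y"] lookup_add
      algebra_simps sum.distrib)

lemma frag_hom_diff: "frag_hom f (x - y) = frag_hom f x - frag_hom f y"
  using frag_hom_add[of f "x - y" y] by (simp add: algebra_simps)

lemma frag_hom_minus: "frag_hom f (- x) = - frag_hom f x"
  using frag_hom_diff[of f 0 x] by simp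

lemma frag_hom_cmul: "frag_hom f (frag_cmul c x) = of_int c * frag_hom f x"
  by (simp add: frag_hom_superset[of "Poly_Mapping.keys x"] keys_cmul algebra_simps sum_distrib_left)

lemma frag_hom_sum: "frag_hom f (sum g I) = (\<Sum>i\<in>I. frag_hom f (g i))"
  by (induction I rule: infinite_finite_induct) (auto simp: frag_hom_add)

lemma frag_hom_extend: "frag_hom f (frag_extend g z) = frag_hom (\<lambda>w. frag_hom f (g w)) z"
  by (simp add: frag_extend_def frag_hom_sum frag_hom_cmul) (simp add: frag_hom_def)

section \<open>Ring homomorphisms and polynomial rings\<close>

context scalar_hom
begin

lemma hom_diff: "h (a - b) = h a - h b"
  using hom_add[of "a - b" b] by (simp add: algebra_simps)

lemma hom_sum: "h (sum f I) = (\<Sum>i\<in>I. h (f i))"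
  by (induction I rule: infinite_finite_induct) (simp_all add: hom_zero hom_add)

end

lemma map_poly_scalar_hom:
  fixes h :: "'a :: comm_ring_1 \<Rightarrow> 'b :: comm_ring_1"
  assumes "scalar_hom h"
  shows "scalar_hom (map_poly h)"
proof -
  interpret scalar_hom h by fact
  have add: "map_poly h (p + q) = map_poly h p + map_poly h q" for p q
    by (rule poly_eqI) (simp add: coeff_map_poly hom_zero hom_add)
  have smult: "map_poly h (Polynomial.smult c p) = Polynomial.smult (h c) (map_poly h p)" for c p
    by (rule poly_eqI) (simp add: coeff_map_poly hom_zero hom_mult)
  show ?thesis
  proof
    show "map_poly h (p * q) = map_poly h p * map_poly h q" for p q
      by (induction p) (simp_all add: add smult map_poly_pCons hom_zero)
  qed (simp_all add: add hom_one)
qed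

lemma scalar_hom_compose:
  assumes "scalar_hom g" "scalar_hom h"
  shows "scalar_hom (\<lambda>x. g (h x))"
  using assms by (simp add: scalar_hom_def)

lemma poly_scalar_hom: "scalar_hom (\<lambda>p. poly p (x :: 'a :: comm_ring_1))"
  by standard simp_all

lemma eta_R_scalar_hom: "scalar_hom (eta_R :: 'a :: comm_ring_1 lbuds \<Rightarrow> _)"
  by standard (simp_all add: eta_R_hom)

section \<open>The ring of 2-buds and its graded pieces\<close>

text \<open>Constants and the image of \<open>Dr\<close> generate the symmetric algebra as a ring;
  powers of a variable, monomials and polynomials are reached in turn.\<close>

lemma lbuds_induct [case_names const incl add mult]:
  fixes x :: "'a :: comm_ring_1 lbuds"
  assumes const: "\<And>a. P (lbuds_const a)" and incl: "\<And>d. P (lbuds_incl d)"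
    and add: "\<And>x y. P x \<Longrightarrow> P y \<Longrightarrow> P (x + y)" and mult: "\<And>x y. P x \<Longrightarrow> P y \<Longrightarrow> P (x * y)"
  shows "P x"
proof -
  have one: "P 1" and zero: "P 0" using const[of 1] const[of 0] by simp_all
  have pow: "P (lbuds_incl d ^ n)" for d n
    by (induction n) (auto simp: one incl mult)
  have abs_mult: "abs_lbuds (p * q) = abs_lbuds p * abs_lbuds q" for p q :: "('a Dr \<Rightarrow>\<^sub>0 nat) \<Rightarrow>\<^sub>0 'a"
    by (simp add: times_lbuds.abs_eq)
  have abs_add: "abs_lbuds (p + q) = abs_lbuds p + abs_lbuds q" for p q :: "('a Dr \<Rightarrow>\<^sub>0 nat) \<Rightarrow>\<^sub>0 'a"
    by (simp add: plus_lbuds.abs_eq)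
  have var: "abs_lbuds (Poly_Mapping.single (Poly_Mapping.single d n) 1) = lbuds_incl d ^ n" for d :: "'a Dr" and n
  proof (induction n)
    case (Suc n)
    have "Poly_Mapping.single (Poly_Mapping.single d (Suc n)) (1::'a) =
        sym_var d * Poly_Mapping.single (Poly_Mapping.single d n) 1"
      by (simp add: sym_var_def mult_single flip: single_add)
    then show ?case by (simp add: abs_mult Suc lbuds_incl_def)
  qed (simp add: one_lbuds.abs_eq)
  have mon: "P (abs_lbuds (Poly_Mapping.single \<mu> 1))" for \<mu> :: "'a Dr \<Rightarrow>\<^sub>0 nat"
  proof (induction \<mu> rule: poly_mapping_single_add_induct)
    case (single k v)
    then show ?case by (simp add: var pow)
  next
    case (add f g)
    have "Poly_Mapping.single (f + g) (1::'a) = Poly_Mapping.single f 1 * Poly_Mapping.single g 1"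
      by (simp add: mult_single)
    then show ?case using add by (simp add: abs_mult mult)
  qed
  have "P (abs_lbuds p)" for p :: "('a Dr \<Rightarrow>\<^sub>0 nat) \<Rightarrow>\<^sub>0 'a"
  proof (induction p rule: poly_mapping_single_add_induct)
    case (single \<mu> a)
    have "Poly_Mapping.single \<mu> a = Poly_Mapping.single 0 a * Poly_Mapping.single \<mu> 1"
      by (simp add: mult_single)
    then show ?case by (simp add: abs_mult mult mon const lbuds_const.abs_eq[symmetric])
  next
    case (add f g)
    then show ?case by (simp add: abs_add assms(3))
  qed
  then show ?thesis by (metis Quotient3_abs_rep[OF Quotient3_lbuds])
qed

text \<open>The uniqueness half of the universal property of the symmetric algebra.\<close>

lemma scalar_hom_lbuds_eqI:
  fixes g h :: "'a :: comm_ring_1 lbuds \<Rightarrow> 'b :: comm_ring_1"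
  assumes "scalar_hom g" "scalar_hom h"
    and "\<And>a. g (lbuds_const a) = h (lbuds_const a)" "\<And>d. g (lbuds_incl d) = h (lbuds_incl d)"
  shows "g x = h x"
proof -
  interpret g: scalar_hom g by fact
  interpret h: scalar_hom h by fact
  show ?thesis
    by (induction x rule: lbuds_induct) (simp_all add: assms(3,4) g.hom_add h.hom_add g.hom_mult h.hom_mult)
qed

text \<open>Sending every variable to 0 kills the defining relations and yields a retraction of the
  symmetric algebra onto \<open>A\<close>.\<close>

lemma inj_lbuds_const: "inj (lbuds_const :: 'a :: comm_ring_1 \<Rightarrow> 'a lbuds)"
proof (rule injI)
  fix a b :: 'a
  interpret id_hom: scalar_hom "\<lambda>a :: 'a. a" by standard simp_all
  assume "lbuds_const a = lbuds_const b"
  then have "Poly_Mapping.single 0 a - Poly_Mapping.single 0 b \<in> ideal_span (sym_relations :: (('a Dr \<Rightarrow>\<^sub>0 nat) \<Rightarrow>\<^sub>0 'a) set)"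
    by (simp add: lbuds_const.abs_eq lbuds.abs_eq_iff)
  then have "polynomial_eval (\<lambda>a. a) (\<lambda>_. 0 :: 'a) (Poly_Mapping.single 0 a - Poly_Mapping.single (0 :: 'a Dr \<Rightarrow>\<^sub>0 nat) b) = 0"
  proof (rule id_hom.eval_ideal)
    fix r :: "('a Dr \<Rightarrow>\<^sub>0 nat) \<Rightarrow>\<^sub>0 'a" assume "r \<in> sym_relations"
    then show "polynomial_eval (\<lambda>a. a) (\<lambda>_. 0) r = 0"
      unfolding sym_relations_def by (auto simp: sym_var_def id_hom.eval_diff id_hom.eval_mult)
  qed
  then show "a = b" by (simp add: id_hom.eval_diff)
qed

section \<open>Elements of internal degree at most two\<close>

lemma poly_mapping_eq_single:
  "Poly_Mapping.keys p \<subseteq> {k} \<Longrightarrow> p = Poly_Mapping.single k (Poly_Mapping.lookup p k)"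
  by (rule poly_mapping_eqI) (auto simp: lookup_single when_def in_keys_iff)

lemma lbuds_homogeneous_0: "x \<in> lbuds_homogeneous 0 \<Longrightarrow> \<exists>a. x = lbuds_const a"
proof -
  assume "x \<in> lbuds_homogeneous 0"
  then obtain p where p: "x = abs_lbuds p"
    "\<And>\<mu>. \<mu> \<in> Poly_Mapping.keys p \<Longrightarrow> (\<Sum>x\<in>Poly_Mapping.keys \<mu>. Poly_Mapping.lookup \<mu> x) = 0"
    by (auto simp: lbuds_homogeneous_def)
  have "\<mu> = 0" if "\<mu> \<in> Poly_Mapping.keys p" for \<mu>
    using p(2)[OF that] by (intro poly_mapping_eqI) (auto simp: in_keys_iff)
  then have "p = Poly_Mapping.single 0 (Poly_Mapping.lookup p 0)"
    by (intro poly_mapping_eq_single) auto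
  then show ?thesis unfolding p(1) lbuds_const.abs_eq by metis
qed

text \<open>All monomials have even degree, so none can occur.\<close>

lemma lbuds_homogeneous_1: "x \<in> lbuds_homogeneous 1 \<Longrightarrow> x = 0"
proof -
  assume "x \<in> lbuds_homogeneous 1"
  then obtain p where p: "x = abs_lbuds p"
    "\<And>\<mu>. \<mu> \<in> Poly_Mapping.keys p \<Longrightarrow> 2 * (\<Sum>x\<in>Poly_Mapping.keys \<mu>. Poly_Mapping.lookup \<mu> x) = 1"
    unfolding lbuds_homogeneous_def by blast
  have "p = 0" using p(2) by (metis all_not_in_conv even_mult_iff even_numeral keys_eq_empty odd_one)
  then show ?thesis by (simp add: p(1) zero_lbuds.abs_eq)
qed

lemma lbuds_incl_zero: "lbuds_incl 0 = 0"
  using lbuds_incl_add[of 0 0] by simp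

text \<open>A monomial of total exponent 1 is a single variable, and the relations merge a linear
  combination of variables into one element of \<open>Dr\<close>.\<close>

lemma lbuds_homogeneous_2: "x \<in> lbuds_homogeneous 2 \<Longrightarrow> \<exists>d. x = lbuds_incl d"
proof -
  assume "x \<in> lbuds_homogeneous 2"
  then obtain p where p: "x = abs_lbuds p"
    "\<And>\<mu>. \<mu> \<in> Poly_Mapping.keys p \<Longrightarrow> (\<Sum>x\<in>Poly_Mapping.keys \<mu>. Poly_Mapping.lookup \<mu> x) = 1"
    by (auto simp: lbuds_homogeneous_def)
  have single: "\<exists>d. \<mu> = Poly_Mapping.single d 1" if \<mu>: "\<mu> \<in> Poly_Mapping.keys p" for \<mu>
  proof -
    obtain d where d: "d \<in> Poly_Mapping.keys \<mu>" "Poly_Mapping.lookup \<mu> d = 1"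
        "\<forall>e\<in>Poly_Mapping.keys \<mu>. d \<noteq> e \<longrightarrow> Poly_Mapping.lookup \<mu> e = 0"
      using p(2)[OF \<mu>] unfolding sum_eq_1_iff[OF finite_keys] by blast
    then have "\<mu> = Poly_Mapping.single d (Poly_Mapping.lookup \<mu> d)"
      by (intro poly_mapping_eq_single) (auto simp: in_keys_iff)
    with d show ?thesis by metis
  qed
  have "\<exists>d. abs_lbuds (\<Sum>\<mu>\<in>S. Poly_Mapping.single \<mu> (Poly_Mapping.lookup p \<mu>)) = lbuds_incl d"
    if "finite S" "S \<subseteq> Poly_Mapping.keys p" for S
    using that
  proof (induction S rule: finite_induct)
    case empty
    then show ?case by (auto intro!: exI[of _ 0] simp: lbuds_incl_zero zero_lbuds.abs_eq)
  next
    case (insert \<mu> S)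
    then obtain d e where d: "\<mu> = Poly_Mapping.single e 1"
      "abs_lbuds (\<Sum>\<mu>\<in>S. Poly_Mapping.single \<mu> (Poly_Mapping.lookup p \<mu>)) = lbuds_incl d"
      using single by (metis insert_subset)
    have "Poly_Mapping.single \<mu> (Poly_Mapping.lookup p \<mu>)
        = Poly_Mapping.single 0 (Poly_Mapping.lookup p \<mu>) * sym_var e"
      by (simp add: d(1) sym_var_def mult_single)
    then have "abs_lbuds (Poly_Mapping.single \<mu> (Poly_Mapping.lookup p \<mu>))
        = lbuds_incl (dr_scale (Poly_Mapping.lookup p \<mu>) e)"
      unfolding lbuds_incl_scale unfolding lbuds_const.abs_eq lbuds_incl_def times_lbuds.abs_eq by simp
    then show ?case using insert(1,2) d(2)
      by (auto intro!: exI[of _ "dr_scale (Poly_Mapping.lookup p \<mu>) e + d"]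
          simp: lbuds_incl_add simp flip: plus_lbuds.abs_eq)
  qed
  from this[OF finite_keys order.refl] show ?thesis unfolding p(1) poly_mapping_sum_single[of p, symmetric] .
qed

lemma lbudsB_homogeneous_0: "w \<in> lbudsB_homogeneous 0 \<Longrightarrow> \<exists>a. w = [:lbuds_const a:]"
proof -
  assume w: "w \<in> lbudsB_homogeneous 0"
  have "Polynomial.coeff w i = 0" if "i > 0" for i
    using w that by (force simp: lbudsB_homogeneous_def)
  then have "w = [:Polynomial.coeff w 0:]"
    by (intro poly_eqI) (auto simp: coeff_pCons split: nat.splits)
  moreover have "\<exists>a. Polynomial.coeff w 0 = lbuds_const a"
  \<comment> \<open>Homogeneity constrains nonzero coefficients only; a zero one is
    \<open>lbuds_const 0\<close>.\<close>
  proof (cases "Polynomial.coeff w 0 = 0")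
    case False
    then have "Polynomial.coeff w 0 \<in> lbuds_homogeneous 0" using w by (force simp: lbudsB_homogeneous_def)
    then show ?thesis by (rule lbuds_homogeneous_0)
  qed (metis lbuds_const_simps(1))
  ultimately show ?thesis by metis
qed

lemma lbudsB_homogeneous_2:
  "w \<in> lbudsB_homogeneous 2 \<Longrightarrow> \<exists>d a. w = [:lbuds_incl d, lbuds_const a:]"
proof -
  assume w: "w \<in> lbudsB_homogeneous 2"
  have "Polynomial.coeff w i = 0" if "i > 1" for i
    using w that by (force simp: lbudsB_homogeneous_def)
  then have "w = [:Polynomial.coeff w 0, Polynomial.coeff w 1:]"
    by (intro poly_eqI) (auto simp: coeff_pCons split: nat.splits)
  moreover have "\<exists>a. Polynomial.coeff w 1 = lbuds_const a"
  proof (cases "Polynomial.coeff w 1 = 0")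
    case False
    then have "Polynomial.coeff w 1 \<in> lbuds_homogeneous 0" using w by (force simp: lbudsB_homogeneous_def)
    then show ?thesis by (rule lbuds_homogeneous_0)
  qed (metis lbuds_const_simps(1))
  moreover have "\<exists>d. Polynomial.coeff w 0 = lbuds_incl d"
  proof (cases "Polynomial.coeff w 0 = 0")
    case False
    then have "Polynomial.coeff w 0 \<in> lbuds_homogeneous 2" using w by (force simp: lbudsB_homogeneous_def)
    then show ?thesis by (rule lbuds_homogeneous_2)
  qed (metis lbuds_incl_zero)
  ultimately show ?thesis by metis
qed

lemma lbuds_homogeneous_incl: "lbuds_incl d \<in> lbuds_homogeneous 2"
  unfolding lbuds_incl_def lbuds_homogeneous_def sym_var_def by (intro imageI) simp

lemma lbuds_homogeneous_const: "lbuds_const a \<in> lbuds_homogeneous 0"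
  unfolding lbuds_const.abs_eq lbuds_homogeneous_def by (intro imageI) simp

lemma lbudsB_homogeneous_t: "[:0, lbuds_const a:] \<in> lbudsB_homogeneous 2"
  using lbuds_homogeneous_const by (auto simp: lbudsB_homogeneous_def coeff_pCons split: nat.splits)

section \<open>Normal forms in the cobar complex\<close>

lemma cobar_relations_subgroup: "subgroup (cobar_relations H) (free_Abelian_group UNIV)"
  unfolding cobar_relations_def by (rule group.generate_is_subgroup) auto

lemma cobar_relations_zero: "0 \<in> cobar_relations H"
  using subgroup.one_closed[OF cobar_relations_subgroup] by simp

lemma cobar_relations_add: "x \<in> cobar_relations H \<Longrightarrow> y \<in> cobar_relations H \<Longrightarrow> x + y \<in> cobar_relations H"
  using subgroup.m_closed[OF cobar_relations_subgroup] by fastforce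

lemma cobar_relations_minus: "x \<in> cobar_relations H \<Longrightarrow> - x \<in> cobar_relations H"
  using subgroup.m_inv_closed[OF cobar_relations_subgroup] by fastforce

lemma cobar_relations_diff: "x \<in> cobar_relations H \<Longrightarrow> y \<in> cobar_relations H \<Longrightarrow> x - y \<in> cobar_relations H"
  using cobar_relations_add[OF _ cobar_relations_minus] by fastforce

lemma cobar_relations_add_slot:
  "frag_of (u @ [x + y] @ v, m) - frag_of (u @ [x] @ v, m) - frag_of (u @ [y] @ v, m) \<in> cobar_relations H"
  unfolding cobar_relations_def by (rule generate.incl) blast

lemma cobar_relations_middle:
  "frag_of (u @ [x * right_unit H l, y] @ v, m) - frag_of (u @ [x, left_unit H l * y] @ v, m) \<in> cobar_relations H"
  unfolding cobar_relations_def by (rule generate.incl) blast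

lemma cobar_relations_last:
  "frag_of (u @ [x * right_unit H l], m) - frag_of (u @ [x], l * m) \<in> cobar_relations H"
  unfolding cobar_relations_def by (rule generate.incl) blast

text \<open>Additivity at 0 + 0. In the free group itself a word with a zero slot is not zero, so
  such words need to be discarded explicitly.\<close>

lemma cobar_relations_zero_slot: "frag_of (u @ [0] @ v, m) \<in> cobar_relations H"
  using cobar_relations_minus[OF cobar_relations_add_slot[of u 0 0 v m H]] by simp

lemma cobar_relations_sum_slot:
  "frag_of (u @ [sum f I] @ v, m) - (\<Sum>i\<in>I. frag_of (u @ [f i] @ v, m)) \<in> cobar_relations H"
proof (induction I rule: infinite_finite_induct)
  case (insert i I)
  then show ?case
    using cobar_relations_add[OF cobar_relations_add_slot[of u "f i" "sum f I" v m H] insert.IH]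
    by (simp add: algebra_simps)
qed (use cobar_relations_zero_slot in auto)

lemma cobar_relations_diff_slot:
  "frag_of (u @ [x - y] @ v, m) - (frag_of (u @ [x] @ v, m) - frag_of (u @ [y] @ v, m)) \<in> cobar_relations H"
  using cobar_relations_minus[OF cobar_relations_add_slot[of u "x - y" y v m H]] by (simp add: algebra_simps)

text \<open>The universal property of the tensor products: a function on words that is additive in
  every slot and balanced over L descends to the quotient.\<close>

lemma frag_hom_cobar_relations:
  assumes "z \<in> cobar_relations H"
    and "\<And>u x y v m. f (u @ [x + y] @ v, m) = f (u @ [x] @ v, m) + f (u @ [y] @ v, m)"
    and "\<And>u m m'. f (u, m + m') = f (u, m) + f (u, m')"
    and "\<And>u x l y v m. f (u @ [x * right_unit H l, y] @ v, m) = f (u @ [x, left_unit H l * y] @ v, m)"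
    and "\<And>u x l m. f (u @ [x * right_unit H l], m) = f (u @ [x], l * m)"
  shows "frag_hom f z = 0"
  using assms(1) unfolding cobar_relations_def
proof (induction rule: generate.induct)
  case (incl h)
  then show ?case using assms(2-) by (auto simp: frag_hom_diff)
next
  case (inv h)
  then show ?case using assms(2-) by (auto simp: frag_hom_diff frag_hom_minus)
qed (auto simp: frag_hom_add)

section \<open>Word values and normal forms in lengths one and two\<close>

abbreviation lbuds_relations :: "(('a :: comm_ring_1 lbuds poly list \<times> 'a lbuds) \<Rightarrow>\<^sub>0 int) set" where
  "lbuds_relations \<equiv> cobar_relations lbuds_hopf_algebroid"

lemma lbuds_hopf_algebroid_simps [simp]:
  "left_unit lbuds_hopf_algebroid = eta_L"
  "right_unit lbuds_hopf_algebroid = eta_R"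
  "coproduct lbuds_hopf_algebroid = comult"
  "base_degree lbuds_hopf_algebroid = lbuds_homogeneous"
  "total_degree lbuds_hopf_algebroid = lbudsB_homogeneous"
  by (simp_all add: lbuds_hopf_algebroid_def)

interpretation eta_R: scalar_hom "eta_R :: 'a :: comm_ring_1 lbuds \<Rightarrow> 'a lbuds poly"
  by (rule eta_R_scalar_hom)

interpretation map_eta_R: scalar_hom "map_poly eta_R :: 'a :: comm_ring_1 lbuds poly \<Rightarrow> 'a lbuds poly poly"
  by (rule map_poly_scalar_hom[OF eta_R_scalar_hom])

text \<open>
  The values in \<open>\<Gamma> \<otimes>\<^sub>L L = \<Gamma>\<close> and in \<open>\<Gamma> \<otimes>\<^sub>L \<Gamma> \<otimes>\<^sub>L L = \<Gamma>[t]\<close>, where \<open>t\<close> belongs to the second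
  factor; coefficients of the second factor move to the first one through the right unit.
\<close>

fun word1_value :: "'a :: comm_ring_1 lbuds poly list \<times> 'a lbuds \<Rightarrow> 'a lbuds poly" where
  "word1_value ([x], m) = x * eta_R m"
| "word1_value _ = 0"

fun word2_value :: "'a :: comm_ring_1 lbuds poly list \<times> 'a lbuds \<Rightarrow> 'a lbuds poly poly" where
  "word2_value ([x, y], m) = Polynomial.smult x (map_poly eta_R (y * eta_R m))"
| "word2_value _ = 0"

lemma word1_value_eq_0: "length w \<noteq> 1 \<Longrightarrow> word1_value (w, m) = 0"
  by (cases "(w, m)" rule: word1_value.cases) auto

lemma word2_value_eq_0: "length w \<noteq> 2 \<Longrightarrow> word2_value (w, m) = 0"
  by (cases "(w, m)" rule: word2_value.cases) auto

lemma word1_value_relations: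
  assumes "z \<in> lbuds_relations" shows "frag_hom word1_value z = 0"
  using assms
proof (rule frag_hom_cobar_relations)
  fix u v :: "'a lbuds poly list" and x y m
  show "word1_value (u @ [x + y] @ v, m) = word1_value (u @ [x] @ v, m) + word1_value (u @ [y] @ v, m)"
    by (cases u; cases v) (auto simp: algebra_simps word1_value_eq_0)
  show "word1_value (u @ [x * right_unit lbuds_hopf_algebroid l, y] @ v, m) =
    word1_value (u @ [x, left_unit lbuds_hopf_algebroid l * y] @ v, m)" for l
    by (simp add: word1_value_eq_0)
next
  fix u :: "'a lbuds poly list" and m m'
  show "word1_value (u, m + m') = word1_value (u, m) + word1_value (u, m')"
    by (cases "(u, m)" rule: word1_value.cases) (auto simp: algebra_simps eta_R.hom_add)
  show "word1_value (u @ [x * right_unit lbuds_hopf_algebroid l], m) = word1_value (u @ [x], l * m)" for x l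
    by (cases u) (auto simp: eta_R.hom_mult mult.assoc word1_value_eq_0)
qed

lemma map_eta_R_eta_L: "map_poly eta_R (eta_L l) = [:eta_R l:]"
  by (simp add: eta_L_def map_poly_pCons eta_R.hom_zero)

text \<open>Balancing at the middle tensor sign holds since \<open>map_poly eta_R\<close> turns the
  left unit of \<open>l\<close> into the constant \<open>eta_R l\<close>, which joins the first
  factor.\<close>

lemma word2_value_relations:
  assumes "z \<in> lbuds_relations" shows "frag_hom word2_value z = 0"
  using assms
proof (rule frag_hom_cobar_relations)
  fix u v :: "'a lbuds poly list" and x y m
  show "word2_value (u @ [x + y] @ v, m) = word2_value (u @ [x] @ v, m) + word2_value (u @ [y] @ v, m)"
  proof (cases "length u + length v = 1")
    case True
    then consider (left) b where "u = []" "v = [b]" | (right) a where "u = [a]" "v = []"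
      by (cases u; cases v) auto
    then show ?thesis
      by cases (simp_all add: distrib_right smult_add_left smult_add_right map_eta_R.hom_add)
  qed (simp add: word2_value_eq_0)
  show "word2_value (u @ [x * right_unit lbuds_hopf_algebroid l, y] @ v, m) =
    word2_value (u @ [x, left_unit lbuds_hopf_algebroid l * y] @ v, m)" for l
    by (cases u; cases v) (simp_all add: map_eta_R.hom_mult map_eta_R_eta_L word2_value_eq_0)
next
  fix u :: "'a lbuds poly list" and m m'
  show "word2_value (u, m + m') = word2_value (u, m) + word2_value (u, m')"
    by (cases "(u, m)" rule: word2_value.cases)
      (auto simp: distrib_left eta_R.hom_add map_eta_R.hom_add smult_add_right)
  show "word2_value (u @ [x * right_unit lbuds_hopf_algebroid l], m) = word2_value (u @ [x], l * m)" for x l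
  proof (cases "length u = 1")
    case True
    then obtain a where "u = [a]" by (auto simp: length_Suc_conv)
    then show ?thesis by (simp add: eta_R.hom_mult mult.assoc)
  qed (simp add: word2_value_eq_0)
qed

text \<open>Moving \<open>m\<close> across the tensor sign replaces x \<otimes> m by x \<eta>_R(m)
  \<otimes> 1, and additivity collects the words. Together with \<open>word1_value_relations\<close>
  this decides congruence in length one.\<close>

lemma word1_normal_form:
  assumes "Poly_Mapping.keys z \<subseteq> {(w, m). length w = 1}"
  shows "z - frag_of ([frag_hom word1_value z], 1) \<in> lbuds_relations"
  using assms
proof (induction z rule: frag_induction)
  case zero
  then show ?case using cobar_relations_minus[OF cobar_relations_zero_slot[of "[]" "[]"]] by simp
next
  case (one w)
  then obtain x m where w: "w = ([x], m)" by (auto simp: length_Suc_conv)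
  show ?case
    using cobar_relations_minus[OF cobar_relations_last[of "[]" x lbuds_hopf_algebroid m 1]] by (simp add: w)
next
  case (diff a b)
  then show ?case
    using cobar_relations_diff[OF cobar_relations_diff[OF diff.IH]
        cobar_relations_diff_slot[of "[]" "frag_hom word1_value a" "frag_hom word1_value b" "[]" 1 lbuds_hopf_algebroid]]
    by (simp add: frag_hom_diff algebra_simps)
qed

text \<open>The expansion in powers of the second variable, as words. The cutoff is a parameter
  because a word with slot 0 is only congruent to 0; a common cutoff lets two normal forms be
  subtracted term by term.\<close>

definition word2_normal :: "nat \<Rightarrow> 'a :: comm_ring_1 lbuds poly poly \<Rightarrow> ('a lbuds poly list \<times> 'a lbuds) \<Rightarrow>\<^sub>0 int" where
  "word2_normal n q = (\<Sum>k<n. frag_of ([Polynomial.coeff q k, Polynomial.monom 1 k], 1))"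

lemma cobar_relations_sum: "(\<And>i. i \<in> I \<Longrightarrow> f i \<in> cobar_relations H) \<Longrightarrow> sum f I \<in> cobar_relations H"
  by (induction I rule: infinite_finite_induct) (auto intro: cobar_relations_zero cobar_relations_add)

lemma word2_normal_form_frag_of:
  "\<exists>N. \<forall>n\<ge>N. frag_of ([x, y], m) - word2_normal n (word2_value ([x, y], m)) \<in> lbuds_relations"
proof -
  let ?p = "y * eta_R m"
  \<comment> \<open>The bound is the degree of the second factor before its coefficients move to the
    first one; that move can only lower the degree.\<close>
  have "frag_of ([x, y], m) - word2_normal n (word2_value ([x, y], m)) \<in> lbuds_relations"
    if n: "n > degree ?p" for n
  proof -
    let ?c = "Polynomial.coeff ?p"
    have p: "?p = (\<Sum>k<n. Polynomial.monom (?c k) k)"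
    proof -
      have "?p = (\<Sum>k\<le>n - 1. Polynomial.monom (?c k) k)"
        by (rule poly_as_sum_of_monoms'[symmetric]) (use n in simp)
      also have "{..n - 1} = {..<n}" using n by auto
      finally show ?thesis .
    qed
    have 1: "frag_of ([x, ?p], 1) - frag_of ([x, y], m) \<in> lbuds_relations"
      using cobar_relations_last[of "[x]" y lbuds_hopf_algebroid m 1] by simp
    have 2: "frag_of ([x, ?p], 1) - (\<Sum>k<n. frag_of ([x, Polynomial.monom (?c k) k], 1)) \<in> lbuds_relations"
      using cobar_relations_sum_slot[of "[x]" "\<lambda>k. Polynomial.monom (?c k) k" "{..<n}" "[]" 1 lbuds_hopf_algebroid]
      unfolding p[symmetric] by simp
    have 3: "(\<Sum>k<n. frag_of ([x * eta_R (?c k), Polynomial.monom 1 k], 1)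
        - frag_of ([x, Polynomial.monom (?c k) k], 1)) \<in> lbuds_relations"
    proof (rule cobar_relations_sum)
      fix k
      show "frag_of ([x * eta_R (?c k), Polynomial.monom 1 k], 1)
        - frag_of ([x, Polynomial.monom (?c k) k], 1) \<in> lbuds_relations"
        using cobar_relations_middle[of "[]" x lbuds_hopf_algebroid "?c k" "Polynomial.monom 1 k" "[]" 1]
        by (simp add: eta_L_def smult_monom)
    qed
    have "word2_normal n (word2_value ([x, y], m)) = (\<Sum>k<n. frag_of ([x * eta_R (?c k), Polynomial.monom 1 k], 1))"
      by (simp add: word2_normal_def coeff_map_poly eta_R.hom_zero)
    with cobar_relations_diff[OF cobar_relations_diff[OF 2 1] 3] show ?thesis
      by (simp add: sum_subtractf algebra_simps)
  qed
  then show ?thesis by (metis Suc_le_eq)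
qed

lemma word2_normal_form:
  assumes "Poly_Mapping.keys z \<subseteq> {(w, m). length w = 2}"
  shows "\<exists>N. \<forall>n\<ge>N. z - word2_normal n (frag_hom word2_value z) \<in> lbuds_relations"
  using assms
proof (induction z rule: frag_induction)
  case zero
  have "- (\<Sum>k<n. frag_of ([0 :: 'a lbuds poly, Polynomial.monom 1 k], 1)) \<in> lbuds_relations" for n
    using cobar_relations_zero_slot[of "[]"] by (intro cobar_relations_minus cobar_relations_sum) simp
  then show ?case by (intro exI[of _ 0]) (simp add: word2_normal_def)
next
  case (one w)
  then obtain x y m where w: "w = ([x, y], m)" by (auto simp: length_Suc_conv numeral_2_eq_2)
  show ?case unfolding w frag_hom_of by (rule word2_normal_form_frag_of)
next
  case (diff a b)
  then obtain M N where
    MN: "\<And>n. n \<ge> M \<Longrightarrow> a - word2_normal n (frag_hom word2_value a) \<in> lbuds_relations"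
    "\<And>n. n \<ge> N \<Longrightarrow> b - word2_normal n (frag_hom word2_value b) \<in> lbuds_relations" by metis
  have lin: "word2_normal n (p - q) - (word2_normal n p - word2_normal n q) \<in> lbuds_relations" for n and p q :: "'a lbuds poly poly"
  proof -
    have "(\<Sum>k<n. frag_of ([Polynomial.coeff p k - Polynomial.coeff q k, Polynomial.monom 1 k], 1)
      - (frag_of ([Polynomial.coeff p k, Polynomial.monom 1 k], 1) - frag_of ([Polynomial.coeff q k, Polynomial.monom 1 k], 1)))
      \<in> lbuds_relations"
      using cobar_relations_diff_slot[of "[]"] by (intro cobar_relations_sum) simp
    then show ?thesis by (simp add: word2_normal_def sum_subtractf)
  qed
  have "a - b - word2_normal n (frag_hom word2_value (a - b)) \<in> lbuds_relations" if "n \<ge> max M N" for n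
    using cobar_relations_diff[OF cobar_relations_diff[OF MN(1)[of n] MN(2)[of n]]
        lin[of n "frag_hom word2_value a" "frag_hom word2_value b"]] that
    by (simp add: frag_hom_diff algebra_simps)
  then show ?case by blast
qed

text \<open>The normal form of value 0 consists of words with a zero slot. The cocycle condition
  thereby becomes an equation between polynomials.\<close>

lemma word2_relations_iff:
  assumes "Poly_Mapping.keys z \<subseteq> {(w, m). length w = 2}"
  shows "z \<in> lbuds_relations \<longleftrightarrow> frag_hom word2_value z = 0"
proof
  assume 0: "frag_hom word2_value z = 0"
  obtain n where "z - word2_normal n (frag_hom word2_value z) \<in> lbuds_relations"
    using word2_normal_form[OF assms] by blast
  moreover have "word2_normal n 0 \<in> lbuds_relations"
    unfolding word2_normal_def using cobar_relations_zero_slot[of "[]"] by (intro cobar_relations_sum) simp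
  ultimately have "z - word2_normal n 0 + word2_normal n 0 \<in> lbuds_relations"
    unfolding 0 by (rule cobar_relations_add)
  then show "z \<in> lbuds_relations" by simp
qed (rule word2_value_relations)

text \<open>The coproduct as substitution of t_1 + t_2 for t, with t_1 the inner and t_2 the outer
  polynomial variable. In this form it is visibly a ring homomorphism.\<close>

definition comult_poly :: "'a :: comm_ring_1 lbuds poly \<Rightarrow> 'a lbuds poly poly" where
  "comult_poly p = poly (map_poly (\<lambda>c. [:[:c:]:]) p) [:[:0, 1:], 1:]"

lemma comult_poly_scalar_hom: "scalar_hom (comult_poly :: 'a :: comm_ring_1 lbuds poly \<Rightarrow> _)"
proof -
  have "scalar_hom (\<lambda>c :: 'a lbuds. [:[:c:]:])" by standard (auto simp: one_pCons)
  from scalar_hom_compose[OF poly_scalar_hom map_poly_scalar_hom[OF this]]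
  show ?thesis by (simp add: comult_poly_def[abs_def])
qed

interpretation comult_poly: scalar_hom "comult_poly :: 'a :: comm_ring_1 lbuds poly \<Rightarrow> 'a lbuds poly poly"
  by (rule comult_poly_scalar_hom)

lemma comult_poly_linear: "comult_poly [:a, b:] = [:[:a, b:], [:b:]:]"
  by (simp add: comult_poly_def map_poly_pCons)

text \<open>The Hopf algebroid identity \<Delta>(\<eta>_R m) = 1 \<otimes> \<eta>_R m. Both sides
  are ring homomorphisms in \<open>m\<close>, so constants and elements of \<open>Dr\<close>
  suffice.\<close>

lemma comult_poly_eta_R: "comult_poly (eta_R m) = map_poly eta_R (eta_R m)"
proof (rule scalar_hom_lbuds_eqI)
  show "scalar_hom (\<lambda>m :: 'a lbuds. comult_poly (eta_R m))"
    by (rule scalar_hom_compose[OF comult_poly_scalar_hom eta_R_scalar_hom])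
  show "scalar_hom (\<lambda>m :: 'a lbuds. map_poly eta_R (eta_R m))"
    by (rule scalar_hom_compose[OF map_poly_scalar_hom[OF eta_R_scalar_hom] eta_R_scalar_hom])
  show "comult_poly (eta_R (lbuds_const a)) = map_poly eta_R (eta_R (lbuds_const a))" for a :: 'a
    using comult_poly_linear[of "lbuds_const a" 0] by (simp add: eta_R_hom map_poly_pCons)
  show "comult_poly (eta_R (lbuds_incl d)) = map_poly eta_R (eta_R (lbuds_incl d))" for d :: "'a Dr"
    by (simp add: eta_R_hom map_poly_pCons comult_poly_linear)
qed

lemma comult_poly_monom:
  "comult_poly (Polynomial.monom c k) =
     (\<Sum>j\<le>k. of_nat (k choose j) * [:Polynomial.monom c j:] * Polynomial.monom 1 (k - j))"
proof -
  have "comult_poly (Polynomial.monom c k) = [:[:c:]:] * ([:[:0, 1:]:] + Polynomial.monom 1 1) ^ k"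
    by (simp add: comult_poly_def map_poly_monom poly_monom monom_Suc monom_0 one_pCons)
  also have "\<dots> = (\<Sum>j\<le>k. of_nat (k choose j) * ([:[:c:]:] * [:[:0, 1:]:] ^ j) * Polynomial.monom 1 1 ^ (k - j))"
    by (simp only: binomial_ring sum_distrib_left mult_ac)
  also have "\<dots> = (\<Sum>j\<le>k. of_nat (k choose j) * [:Polynomial.monom c j:] * Polynomial.monom 1 (k - j))"
  proof -
    have "[:[:c:]:] * [:[:0, 1:]:] ^ j = [:Polynomial.monom c j:]" for j
      by (induction j) (simp_all add: monom_0 monom_Suc mult.left_commute)
    moreover have "Polynomial.monom (1 :: 'a lbuds poly) 1 ^ j = Polynomial.monom 1 j" for j
      by (simp add: monom_power)
    ultimately show ?thesis by simp
  qed
  finally show ?thesis .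
qed

text \<open>By \<open>comult_poly_eta_R\<close> the coefficient \<open>m\<close> can be absorbed
  before the coproduct is taken.\<close>

lemma word2_value_comult:
  "frag_hom (\<lambda>(x, y). word2_value ([x, y], m)) (comult p) = comult_poly (p * eta_R m)"
proof -
  have fin: "finite {k. Polynomial.coeff p k \<noteq> 0}"
    by (rule finite_subset[of _ "{..degree p}"]) (auto intro: le_degree)
  have "frag_hom (\<lambda>(x, y). word2_value ([x, y], m)) (comult p) =
      (\<Sum>k | Polynomial.coeff p k \<noteq> 0. comult_poly (Polynomial.monom (Polynomial.coeff p k) k))
        * map_poly eta_R (eta_R m)"
    by (simp add: comult_def frag_hom_sum frag_hom_cmul comult_poly_monom sum_distrib_right
        map_eta_R.hom_mult map_poly_monom eta_R.hom_zero eta_R.hom_one mult.assoc)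
  \<comment> \<open>The indices added here have coefficient 0 and contribute the coproduct of
    0.\<close>
  also have "(\<Sum>k | Polynomial.coeff p k \<noteq> 0. comult_poly (Polynomial.monom (Polynomial.coeff p k) k))
      = (\<Sum>k\<le>degree p. comult_poly (Polynomial.monom (Polynomial.coeff p k) k))"
    by (rule sum.mono_neutral_left) (auto intro: le_degree simp: comult_poly.hom_zero)
  also have "\<dots> = comult_poly (\<Sum>k\<le>degree p. Polynomial.monom (Polynomial.coeff p k) k)"
    by (simp add: comult_poly.hom_sum)
  also have "\<dots> * map_poly eta_R (eta_R m) = comult_poly (p * eta_R m)"
    by (simp add: poly_as_sum_of_monoms comult_poly.hom_mult comult_poly_eta_R)
  finally show ?thesis .
qed

text \<open>The three terms are 1 \<otimes> p, \<Delta>(p) and p \<otimes> 1. In the last one the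
  left unit of the coefficient becomes its right unit on crossing to the first factor, so everything
  depends on the value \<open>p\<close> alone.\<close>

lemma word2_value_cobar_differential:
  assumes "Poly_Mapping.keys z \<subseteq> {(w, m). length w = 1}"
  defines "p \<equiv> frag_hom word1_value z"
  shows "frag_hom word2_value (cobar_differential lbuds_hopf_algebroid z)
    = map_poly eta_R p - comult_poly p + [:p:]"
  using assms(1) unfolding p_def
proof (induction z rule: frag_induction)
  case zero
  then show ?case by (simp add: cobar_differential_def comult_poly.hom_zero)
next
  case (one w)
  then obtain x m where w: "w = ([x], m)" by (auto simp: length_Suc_conv)
  have "frag_hom word2_value (frag_extend (\<lambda>(y, z). frag_of ([y, z], m)) (comult x)) = comult_poly (x * eta_R m)"
    unfolding frag_hom_extend word2_value_comult[symmetric] by (rule arg_cong2[of _ _ _ _ frag_hom]) auto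
  then show ?case
    by (simp add: w cobar_differential_def frag_hom_add frag_hom_minus frag_hom_diff
        map_eta_R_eta_L eta_R.hom_one map_eta_R.hom_mult case_prod_unfold)
next
  case (diff a b)
  then show ?case
    by (simp add: cobar_differential_def frag_extend_diff frag_hom_diff map_eta_R.hom_diff comult_poly.hom_diff)
qed

text \<open>Makes the normal forms applicable to differentials, since they concern words of one
  fixed length.\<close>

lemma keys_cobar_differential:
  fixes H :: "('a :: comm_ring_1, 'b :: comm_ring_1) graded_hopf_algebroid"
  assumes "Poly_Mapping.keys z \<subseteq> {(w, m). length w = s}"
  shows "Poly_Mapping.keys (cobar_differential H z) \<subseteq> {(w, m). length w = Suc s}"
  using assms
proof (induction z rule: frag_induction)
  case zero
  then show ?case by (simp add: cobar_differential_def)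
next
  case (one w)
  let ?S = "{(w, m). length w = Suc s} :: ('b list \<times> 'a) set"
  have extend: "Poly_Mapping.keys (frag_extend g c) \<subseteq> ?S" if "\<And>k. Poly_Mapping.keys (g k) \<subseteq> ?S"
    for g :: "'b \<times> 'b \<Rightarrow> _" and c
    using keys_frag_extend[of g c] that by blast
  have cmul: "Poly_Mapping.keys (frag_cmul k c) \<subseteq> ?S" if "Poly_Mapping.keys c \<subseteq> ?S" for k c
    by (rule subset_trans[OF keys_cmul that])
  have plus: "Poly_Mapping.keys (a + b) \<subseteq> ?S"
    if "Poly_Mapping.keys a \<subseteq> ?S" "Poly_Mapping.keys b \<subseteq> ?S" for a b
    by (rule subset_trans[OF Poly_Mapping.keys_add Un_least[OF that]])
  have sum: "Poly_Mapping.keys (sum f I) \<subseteq> ?S" if "\<And>i. i \<in> I \<Longrightarrow> Poly_Mapping.keys (f i) \<subseteq> ?S"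
    for f and I :: "nat set"
    using that by (induction I rule: infinite_finite_induct) (simp_all add: plus)
  obtain u m where w: "w = (u, m)" "length u = s" using one by auto
  show ?case unfolding w(1) cobar_differential_def frag_extend_of prod.case
    by (intro plus sum cmul extend) (auto simp: w(2))
next
  case (diff a b)
  then show ?case using keys_diff[of "cobar_differential H a" "cobar_differential H b"]
    by (auto simp: cobar_differential_def frag_extend_diff)
qed

section \<open>The first cohomology group\<close>

text \<open>Counts cosets by any complete invariant: it is enough that the fibres of
  \<open>f\<close> are the cosets, and each value is sent to the coset of a chosen preimage.\<close>

lemma (in group) bij_betw_rcosets:
  assumes H: "subgroup H G"
    and f: "\<And>x y. x \<in> carrier G \<Longrightarrow> y \<in> carrier G \<Longrightarrow> f x = f y \<longleftrightarrow> x \<otimes> inv y \<in> H"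
  shows "bij_betw (\<lambda>v. H #> inv_into (carrier G) f v) (f ` carrier G) (rcosets H)"
proof -
  have coset_eq: "H #> x = H #> y \<longleftrightarrow> f x = f y" if "x \<in> carrier G" "y \<in> carrier G" for x y
  proof
    assume "H #> x = H #> y"
    then have "x \<in> H #> y" using rcos_self[OF that(1) H] by simp
    then show "f x = f y" using subgroup.rcos_module[OF H is_group that(2,1)] f[OF that] by simp
  next
    assume "f x = f y"
    then have "x \<in> H #> y" using subgroup.rcos_module[OF H is_group that(2,1)] f[OF that] by simp
    then show "H #> x = H #> y" using repr_independence[OF _ that(2) H] by simp
  qed
  show ?thesis
  proof (rule bij_betwI')
    fix v w assume v: "v \<in> f ` carrier G"
    show "H #> inv_into (carrier G) f v \<in> rcosets H"
      using inv_into_into[OF v] by (auto simp: RCOSETS_def)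
    assume w: "w \<in> f ` carrier G"
    show "(H #> inv_into (carrier G) f v = H #> inv_into (carrier G) f w) = (v = w)"
      using coset_eq[OF inv_into_into[OF v] inv_into_into[OF w]] v w by (simp add: f_inv_into_f)
  next
    fix C assume "C \<in> rcosets H"
    then obtain x where x: "x \<in> carrier G" "C = H #> x" by (auto simp: RCOSETS_def)
    have y: "inv_into (carrier G) f (f x) \<in> carrier G" using x by (simp add: inv_into_into)
    have "C = H #> inv_into (carrier G) f (f x)"
      unfolding x(2) coset_eq[OF x(1) y] using x(1) by (simp add: f_inv_into_f)
    then show "\<exists>v\<in>f ` carrier G. C = H #> inv_into (carrier G) f v" using x(1) by blast
  qed
qed

section \<open>Cochains, cocycles and coboundaries in internal degree two\<close>

lemma dr_twist_zero [simp]: "dr_twist 0 = 0"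
  using dr_twist_simps(3)[of 0 0] by simp

lemma dr_twist_diff: "dr_twist (x - y) = dr_twist x - dr_twist y"
  using dr_twist_simps(3)[of "x - y" y] by simp

lemma lbuds_incl_diff: "lbuds_incl (x - y) = lbuds_incl x - lbuds_incl y"
  using lbuds_incl_add[of "x - y" y] by (simp add: algebra_simps)

text \<open>On words without slots the differential is \<eta>_R - \<eta>_L, and on \<open>Dr\<close>
  the two units differ by \<open>dr_twist\<close> times t.\<close>

lemma word1_value_cobar_differential_0:
  assumes "y \<in> carrier (cobar_chains lbuds_hopf_algebroid 0 2)"
  shows "\<exists>d. frag_hom word1_value (cobar_differential lbuds_hopf_algebroid y) = [:0, lbuds_const (dr_twist d):]"
proof -
  have "Poly_Mapping.keys y \<subseteq> {(w, m). w = [] \<and> m \<in> lbuds_homogeneous 2}"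
    using assms by (auto simp: cobar_chains_def)
  then show ?thesis
  proof (induction y rule: frag_induction)
    case zero
    show ?case by (rule exI[of _ 0]) (simp add: cobar_differential_def)
  next
    case (one w)
    then obtain d where w: "w = ([], lbuds_incl d)" using lbuds_homogeneous_2 by auto
    show ?case
      by (rule exI[of _ d])
        (simp add: w cobar_differential_def frag_hom_diff eta_L_def eta_R.hom_one eta_R_hom)
  next
    case (diff a b)
    then obtain d e where "frag_hom word1_value (cobar_differential lbuds_hopf_algebroid a) = [:0, lbuds_const (dr_twist d):]"
      "frag_hom word1_value (cobar_differential lbuds_hopf_algebroid b) = [:0, lbuds_const (dr_twist e):]" by blast
    then show ?case
      by (intro exI[of _ "d - e"])
        (simp add: cobar_differential_def frag_extend_diff frag_hom_diff dr_twist_diff)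
  qed
qed

text \<open>Only the degree splittings 0 + 2 and 2 + 0 contribute; in the first the right unit of
  the coefficient supplies the multiple of t.\<close>

lemma word1_value_chain:
  assumes "z \<in> carrier (cobar_chains lbuds_hopf_algebroid 1 2)"
  shows "\<exists>d a. frag_hom word1_value z = [:lbuds_incl d, lbuds_const a:]"
proof -
  have "Poly_Mapping.keys z \<subseteq> {(w, m). \<exists>x k e. w = [x] \<and> x \<in> lbudsB_homogeneous k \<and> m \<in> lbuds_homogeneous e \<and> k + e = 2}"
    using assms by (fastforce simp: cobar_chains_def length_Suc_conv list_all2_Cons1)
  then show ?thesis
  proof (induction z rule: frag_induction)
    case zero
    show ?case by (auto intro!: exI[of _ 0] simp: lbuds_incl_zero)
  next
    case (one w)
    then obtain x m k e where w: "w = ([x], m)"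
      and *: "x \<in> lbudsB_homogeneous k" "m \<in> lbuds_homogeneous e" "k + e = 2" by auto
    then consider "k = 0" "e = 2" | "k = 1" "e = 1" | "k = 2" "e = 0" by linarith
    then show ?case
    proof cases
      case 1
      then obtain a d where "x = [:lbuds_const a:]" "m = lbuds_incl d"
        using * lbudsB_homogeneous_0 lbuds_homogeneous_2 by metis
      then have "frag_hom word1_value (frag_of w) = [:lbuds_incl (dr_scale a d), lbuds_const (a * dr_twist d):]"
        by (simp add: w eta_R_hom lbuds_incl_scale)
      then show ?thesis by blast
    next
      case 2
      then have "m = 0" using * lbuds_homogeneous_1 by auto
      then have "frag_hom word1_value (frag_of w) = [:lbuds_incl 0, lbuds_const 0:]"
        by (simp add: w eta_R_hom lbuds_incl_zero)
      then show ?thesis by blast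
    next
      case 3
      then obtain a d b where "x = [:lbuds_incl d, lbuds_const a:]" "m = lbuds_const b"
        using * lbudsB_homogeneous_2 lbuds_homogeneous_0 by metis
      then have "frag_hom word1_value (frag_of w) = [:lbuds_incl (dr_scale b d), lbuds_const (b * a):]"
        by (simp add: w eta_R_hom lbuds_incl_scale)
      then show ?thesis by blast
    qed
  next
    case (diff a b)
    then obtain d c e f where "frag_hom word1_value a = [:lbuds_incl d, lbuds_const c:]"
      "frag_hom word1_value b = [:lbuds_incl e, lbuds_const f:]" by blast
    then have "frag_hom word1_value (a - b) = [:lbuds_incl (d - e), lbuds_const (c - f):]"
      by (simp add: frag_hom_diff lbuds_incl_diff)
    then show ?case by blast
  qed
qed

lemma keys_cobar_chains:
  "z \<in> carrier (cobar_chains H s d) \<Longrightarrow> Poly_Mapping.keys z \<subseteq> {(w, m). length w = s}"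
  by (auto simp: cobar_chains_def)

lemma lbuds_cocycle_iff:
  "z \<in> cobar_cocycles lbuds_hopf_algebroid 1 2 \<longleftrightarrow>
     z \<in> carrier (cobar_chains lbuds_hopf_algebroid 1 2) \<and> (\<exists>a. frag_hom word1_value z = [:0, lbuds_const a:])"
proof (cases "z \<in> carrier (cobar_chains lbuds_hopf_algebroid 1 2)")
  case True
  obtain d a where da: "frag_hom word1_value z = [:lbuds_incl d, lbuds_const a:]"
    using word1_value_chain[OF True] by blast
  have keys: "Poly_Mapping.keys (cobar_differential lbuds_hopf_algebroid z) \<subseteq> {(w, m). length w = 2}"
    using keys_cobar_differential[OF keys_cobar_chains[OF True]] by (simp add: numeral_2_eq_2)
  have "z \<in> cobar_cocycles lbuds_hopf_algebroid 1 2 \<longleftrightarrow>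
      frag_hom word2_value (cobar_differential lbuds_hopf_algebroid z) = 0"
    using True word2_relations_iff[OF keys] by (simp add: cobar_cocycles_def)
  \<comment> \<open>In \<Delta>(p) the scalar \<open>a\<close> multiplies t_1 + t_2. The t_2 part
    cancels against 1 \<otimes> p and the t_1 part against p \<otimes> 1, leaving the right unit of
    \<open>lbuds_incl d\<close>.\<close>
  also have "\<dots> \<longleftrightarrow> [:eta_R (lbuds_incl d):] - [:[:0, lbuds_const a:]:] + [:[:0, lbuds_const a:]:] = 0"
    unfolding word2_value_cobar_differential[OF keys_cobar_chains[OF True]] da
    by (simp add: map_poly_pCons comult_poly_linear eta_R_hom)
  also have "\<dots> \<longleftrightarrow> lbuds_incl d = 0"
  proof
    assume "[:eta_R (lbuds_incl d):] - [:[:0, lbuds_const a:]:] + [:[:0, lbuds_const a:]:] = 0"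
    \<comment> \<open>The constant coefficient of this right unit is \<open>lbuds_incl d\<close>
      itself.\<close>
    then have "Polynomial.coeff (eta_R (lbuds_incl d)) 0 = 0" by simp
    then show "lbuds_incl d = 0" by (simp add: eta_R_hom)
  qed (simp add: eta_R.hom_zero)
  also have "\<dots> \<longleftrightarrow> (\<exists>a. frag_hom word1_value z = [:0, lbuds_const a:])"
    by (auto simp: da)
  finally show ?thesis using True by simp
qed (simp add: cobar_cocycles_def)

text \<open>For sufficiency, \<open>z\<close> and the differential of the empty word with
  coefficient \<open>lbuds_incl d\<close> have the same value, hence the same normal form, and so
  differ by a relation.\<close>

lemma lbuds_coboundary_iff:
  "z \<in> cobar_coboundaries lbuds_hopf_algebroid 1 2 \<longleftrightarrow>
     z \<in> carrier (cobar_chains lbuds_hopf_algebroid 1 2) \<and>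
     (\<exists>d. frag_hom word1_value z = [:0, lbuds_const (dr_twist d):])" (is "?l \<longleftrightarrow> ?C \<and> ?r")
proof (intro iffI conjI; (elim conjE)?)
  assume l: ?l
  then show ?C by (simp add: cobar_coboundaries_def)
  from l obtain y where y: "y \<in> carrier (cobar_chains lbuds_hopf_algebroid 0 2)"
    "z - cobar_differential lbuds_hopf_algebroid y \<in> lbuds_relations"
    by (auto simp: cobar_coboundaries_def)
  from word1_value_relations[OF y(2)] word1_value_cobar_differential_0[OF y(1)]
  show ?r by (simp add: frag_hom_diff)
next
  assume C: ?C and ?r
  then obtain d where d: "frag_hom word1_value z = [:0, lbuds_const (dr_twist d):]" by blast
  define y :: "('a lbuds poly list \<times> 'a lbuds) \<Rightarrow>\<^sub>0 int" where "y = frag_of ([], lbuds_incl d)"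
  let ?dy = "cobar_differential lbuds_hopf_algebroid y"
  have y: "y \<in> carrier (cobar_chains lbuds_hopf_algebroid 0 2)"
    by (simp add: y_def cobar_chains_def lbuds_homogeneous_incl)
  have val: "frag_hom word1_value ?dy = frag_hom word1_value z"
    by (simp add: d y_def cobar_differential_def frag_hom_diff eta_L_def eta_R.hom_one eta_R_hom)
  have "Poly_Mapping.keys ?dy \<subseteq> {(w, m). length w = 1}"
    using keys_cobar_differential[OF keys_cobar_chains[OF y]] by simp
  from cobar_relations_diff[OF word1_normal_form[OF keys_cobar_chains[OF C]] word1_normal_form[OF this]]
  have "z - ?dy \<in> lbuds_relations" by (simp add: val)
  with y C show ?l by (auto simp: cobar_coboundaries_def)
qed

text \<open>The coefficient of t, brought back to \<open>A\<close> along the injection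
  \<open>lbuds_const\<close>; meaningful on cocycles.\<close>

definition cocycle_scalar :: "(('a :: comm_ring_1 lbuds poly list \<times> 'a lbuds) \<Rightarrow>\<^sub>0 int) \<Rightarrow> 'a" where
  "cocycle_scalar z = the_inv lbuds_const (Polynomial.coeff (frag_hom word1_value z) 1)"

lemma word1_value_cocycle:
  "z \<in> cobar_cocycles lbuds_hopf_algebroid 1 2 \<Longrightarrow>
     frag_hom word1_value z = [:0, lbuds_const (cocycle_scalar z):]"
  unfolding lbuds_cocycle_iff cocycle_scalar_def by (auto simp: the_inv_f_f[OF inj_lbuds_const])

lemma cocycle_scalar_t:
  fixes a :: "'a :: comm_ring_1"
  defines "z \<equiv> frag_of ([[:0, lbuds_const a:]], 1)"
  shows "z \<in> cobar_cocycles lbuds_hopf_algebroid 1 2" "cocycle_scalar z = a"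
proof -
  have "z \<in> carrier (cobar_chains lbuds_hopf_algebroid 1 2)"
    using lbudsB_homogeneous_t[of a] lbuds_homogeneous_const[of "1 :: 'a"]
    by (auto simp: z_def cobar_chains_def intro!: exI[of _ "[2]"] exI[of _ 0])
  moreover have val: "frag_hom word1_value z = [:0, lbuds_const a:]"
    by (simp add: z_def eta_R.hom_one)
  ultimately show "z \<in> cobar_cocycles lbuds_hopf_algebroid 1 2" unfolding lbuds_cocycle_iff by blast
  show "cocycle_scalar z = a" by (simp add: cocycle_scalar_def val the_inv_f_f[OF inj_lbuds_const])
qed

section \<open>Cocycles and coboundaries as groups\<close>

lemma cobar_chains_comm_group: "comm_group (cobar_chains H s d)"
  unfolding cobar_chains_def by (rule abelian_free_Abelian_group)

lemma cobar_chains_simps [simp]: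
  "\<one>\<^bsub>cobar_chains H s d\<^esub> = 0" "x \<otimes>\<^bsub>cobar_chains H s d\<^esub> y = x + y"
  "x \<in> carrier (cobar_chains H s d) \<Longrightarrow> inv\<^bsub>cobar_chains H s d\<^esub> x = - x"
  by (simp_all add: cobar_chains_def)

lemma cobar_chains_subgroupI:
  assumes "B \<subseteq> carrier (cobar_chains H s d)" "0 \<in> B" "\<And>x y. x \<in> B \<Longrightarrow> y \<in> B \<Longrightarrow> x - y \<in> B"
  shows "subgroup B (cobar_chains H s d)"
proof -
  interpret comm_group "cobar_chains H s d" by (rule cobar_chains_comm_group)
  have minus: "- x \<in> B" if "x \<in> B" for x using assms(3)[OF assms(2) that] by simp
  show ?thesis
  proof (rule subgroupI)
    fix x y assume x: "x \<in> B" and y: "y \<in> B"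
    show "x \<otimes>\<^bsub>cobar_chains H s d\<^esub> y \<in> B" using assms(3)[OF x minus[OF y]] by simp
  qed (use assms minus in auto)
qed

lemma cobar_chains_diff:
  "x \<in> carrier (cobar_chains H s d) \<Longrightarrow> y \<in> carrier (cobar_chains H s d) \<Longrightarrow> x - y \<in> carrier (cobar_chains H s d)"
  using keys_diff[of x y] by (auto simp: cobar_chains_def)

lemma lbuds_cocycles_subgroup:
  "subgroup (cobar_cocycles lbuds_hopf_algebroid 1 2)
     (cobar_chains (lbuds_hopf_algebroid :: ('a :: comm_ring_1 lbuds, _) graded_hopf_algebroid) 1 2)"
proof (rule cobar_chains_subgroupI)
  show "(0 :: ('a lbuds poly list \<times> 'a lbuds) \<Rightarrow>\<^sub>0 int) \<in> cobar_cocycles lbuds_hopf_algebroid 1 2"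
    unfolding lbuds_cocycle_iff by (auto simp: cobar_chains_def intro!: exI[of _ 0])
  fix x y :: "('a lbuds poly list \<times> 'a lbuds) \<Rightarrow>\<^sub>0 int"
  assume x: "x \<in> cobar_cocycles lbuds_hopf_algebroid 1 2" and y: "y \<in> cobar_cocycles lbuds_hopf_algebroid 1 2"
  have "frag_hom word1_value (x - y) = [:0, lbuds_const (cocycle_scalar x - cocycle_scalar y):]"
    by (simp add: frag_hom_diff word1_value_cocycle[OF x] word1_value_cocycle[OF y])
  then show "x - y \<in> cobar_cocycles lbuds_hopf_algebroid 1 2"
    using x y unfolding lbuds_cocycle_iff by (blast intro: cobar_chains_diff)
qed (use lbuds_cocycle_iff in blast)

lemma lbuds_coboundary_cocycle_iff:
  "z \<in> cobar_coboundaries lbuds_hopf_algebroid 1 2 \<longleftrightarrow>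
     z \<in> cobar_cocycles lbuds_hopf_algebroid 1 2 \<and> cocycle_scalar z \<in> range dr_twist"
  unfolding lbuds_coboundary_iff lbuds_cocycle_iff
  by (auto simp: cocycle_scalar_def the_inv_f_f[OF inj_lbuds_const])

lemma cocycle_scalar_diff:
  assumes "x \<in> cobar_cocycles lbuds_hopf_algebroid 1 2" "y \<in> cobar_cocycles lbuds_hopf_algebroid 1 2"
  shows "cocycle_scalar (x - y) = cocycle_scalar x - cocycle_scalar y"
proof -
  have "frag_hom word1_value (x - y) = [:0, lbuds_const (cocycle_scalar x - cocycle_scalar y):]"
    by (simp add: frag_hom_diff word1_value_cocycle[OF assms(1)] word1_value_cocycle[OF assms(2)])
  \<comment> \<open>\<open>lbuds_const\<close> must stay unsplit over the difference so that its
    inverse applies.\<close>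
  then show ?thesis
    by (subst cocycle_scalar_def) (simp add: the_inv_f_f[OF inj_lbuds_const] del: lbuds_const_simps)
qed

lemma lbuds_coboundaries_subgroup:
  "subgroup (cobar_coboundaries lbuds_hopf_algebroid 1 2)
     (cobar_chains (lbuds_hopf_algebroid :: ('a :: comm_ring_1 lbuds, _) graded_hopf_algebroid) 1 2)"
proof (rule cobar_chains_subgroupI)
  have zero: "(0 :: ('a lbuds poly list \<times> 'a lbuds) \<Rightarrow>\<^sub>0 int) \<in> carrier (cobar_chains lbuds_hopf_algebroid 1 2)"
    by (simp add: cobar_chains_def)
  have "frag_hom word1_value (0 :: ('a lbuds poly list \<times> 'a lbuds) \<Rightarrow>\<^sub>0 int) = [:0, lbuds_const (dr_twist (0 :: 'a Dr)):]"
    by simp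
  then show "(0 :: ('a lbuds poly list \<times> 'a lbuds) \<Rightarrow>\<^sub>0 int) \<in> cobar_coboundaries lbuds_hopf_algebroid 1 2"
    unfolding lbuds_coboundary_iff using zero by blast
  fix x y :: "('a lbuds poly list \<times> 'a lbuds) \<Rightarrow>\<^sub>0 int"
  assume x: "x \<in> cobar_coboundaries lbuds_hopf_algebroid 1 2" and y: "y \<in> cobar_coboundaries lbuds_hopf_algebroid 1 2"
  then obtain d e where "frag_hom word1_value x = [:0, lbuds_const (dr_twist d):]"
    "frag_hom word1_value y = [:0, lbuds_const (dr_twist e):]" unfolding lbuds_coboundary_iff by blast
  then have "frag_hom word1_value (x - y) = [:0, lbuds_const (dr_twist (d - e)):]"
    by (simp add: frag_hom_diff dr_twist_diff)
  then show "x - y \<in> cobar_coboundaries lbuds_hopf_algebroid 1 2"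
    using x y unfolding lbuds_coboundary_iff by (blast intro: cobar_chains_diff)
qed (use lbuds_coboundary_iff in blast)

theorem corollary5p8:
  assumes "noetherian_ring (ring_of_type_algebra :: ('a :: {idom, ring_char_0}) ring)"
  shows "comm_group (flat_cohomology_omega TYPE('a) 1 1)
    \<and> finite (carrier (flat_cohomology_omega TYPE('a) 1 1))
    \<and> finite (F2_points :: ('a \<Rightarrow> bit) set)
    \<and> Coset.order (flat_cohomology_omega TYPE('a) 1 1) = 2 ^ card (F2_points :: ('a \<Rightarrow> bit) set)
    \<and> fps_nth (fps_deriv (zeta_2 TYPE('a)) / zeta_2 TYPE('a)) 0 = of_nat (card (F2_points :: ('a \<Rightarrow> bit) set))"
proof -
  let ?H = "lbuds_hopf_algebroid :: ('a lbuds, 'a lbuds poly) graded_hopf_algebroid"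
  let ?F = "F2_points :: ('a \<Rightarrow> bit) set"
  let ?B = "cobar_coboundaries ?H 1 2"
  let ?Z = "cobar_cocycles ?H 1 2"
  define G where "G = (cobar_chains ?H 1 2)\<lparr>carrier := ?Z\<rparr>"
  have H1: "flat_cohomology_omega TYPE('a) 1 1 = G Mod ?B"
    by (simp add: flat_cohomology_omega_def Cotor_def G_def)
  interpret chains: comm_group "cobar_chains ?H 1 2" by (rule cobar_chains_comm_group)
  interpret G: comm_group G
    unfolding G_def
    by (rule group.group_comm_groupI[OF chains.subgroup_imp_group[OF lbuds_cocycles_subgroup]])
      (simp add: add.commute)
  have carrier: "carrier G = ?Z" by (simp add: G_def)
  have B: "subgroup ?B G"
    unfolding G_def
    by (rule chains.subgroup_incl[OF lbuds_coboundaries_subgroup lbuds_cocycles_subgroup]) (use lbuds_coboundary_cocycle_iff in blast)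
  \<comment> \<open>In a product of copies of F_2 an element is its support; this set stands for the
    class of the scalar in A / I.\<close>
  define points where "points z = {f \<in> ?F. f (cocycle_scalar z) = 1}" for z
  have points_eq: "points x = points y \<longleftrightarrow> x \<otimes>\<^bsub>G\<^esub> inv\<^bsub>G\<^esub> y \<in> ?B" if x: "x \<in> carrier G" and y: "y \<in> carrier G" for x y
  proof -
    have Z: "x \<in> ?Z" "y \<in> ?Z" using x y by (simp_all add: carrier)
    from Z(2) have "y \<in> carrier (cobar_chains ?H 1 2)" using lbuds_cocycle_iff by blast
    then have "inv\<^bsub>G\<^esub> y = - y"
      unfolding G_def chains.m_inv_consistent[OF lbuds_cocycles_subgroup Z(2)] by (rule cobar_chains_simps)
    then have "x \<otimes>\<^bsub>G\<^esub> inv\<^bsub>G\<^esub> y = x - y" by (simp add: G_def)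
    moreover have "x - y \<in> ?Z" using G.m_closed[OF x G.inv_closed[OF y]] calculation by (simp add: carrier)
    ultimately have "x \<otimes>\<^bsub>G\<^esub> inv\<^bsub>G\<^esub> y \<in> ?B \<longleftrightarrow> cocycle_scalar x - cocycle_scalar y \<in> range dr_twist"
      using lbuds_coboundary_cocycle_iff[of "x - y"] cocycle_scalar_diff[OF Z] by metis
    also have "\<dots> \<longleftrightarrow> (\<forall>f\<in>?F. f (cocycle_scalar x) = f (cocycle_scalar y))"
    proof -
      have "f (cocycle_scalar x - cocycle_scalar y) = 0 \<longleftrightarrow> f (cocycle_scalar x) = f (cocycle_scalar y)" if "f \<in> ?F" for f
        unfolding F2_pointsD(6)[OF that]
        by (cases "f (cocycle_scalar x)"; cases "f (cocycle_scalar y)") auto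
      then show ?thesis unfolding range_dr_twist_iff[OF assms] by blast
    qed
    also have "\<dots> \<longleftrightarrow> points x = points y"
    proof -
      have "(b = 1 \<longleftrightarrow> c = 1) \<longleftrightarrow> b = c" for b c :: bit by (cases b; cases c) auto
      then show ?thesis unfolding points_def by blast
    qed
    finally show ?thesis by simp
  qed
  \<comment> \<open>Every subset is attained, by the cocycle a t for an element \<open>a\<close>
    that is 1 exactly on that subset.\<close>
  have image: "points ` carrier G = Pow ?F"
  proof (intro equalityI subsetI)
    fix S assume "S \<in> Pow ?F"
    then obtain a where "{f \<in> ?F. f a = 1} = S" using F2_points_separated[OF assms] by blast
    then have "S = points (frag_of ([[:0, lbuds_const a:]], 1))"
      by (simp add: points_def cocycle_scalar_t)
    then show "S \<in> points ` carrier G" using cocycle_scalar_t(1)[of a] by (simp add: carrier)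
  qed (auto simp: points_def)
  have fin: "finite ?F" by (rule finite_F2_points[OF assms])
  have bij: "bij_betw (\<lambda>v. ?B #>\<^bsub>G\<^esub> inv_into (carrier G) points v) (Pow ?F) (carrier (G Mod ?B))"
    using G.bij_betw_rcosets[OF B points_eq] by (simp add: image FactGroup_def)
  have "Coset.order (G Mod ?B) = 2 ^ card ?F"
    using bij_betw_same_card[OF bij] by (simp add: Coset.order_def card_Pow[OF fin])
  moreover have "finite (carrier (G Mod ?B))"
    using bij_betw_finite[OF bij] fin by simp
  moreover have "comm_group (G Mod ?B)" by (rule G.abelian_FactGroup[OF B])
  moreover have "fps_nth (fps_deriv (zeta_2 TYPE('a)) / zeta_2 TYPE('a)) 0 = of_nat (card ?F)"
    by (simp only: zeta_2_log_deriv_0 num_points_1)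
  ultimately show ?thesis unfolding H1 using fin by blast
qed

end
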